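(* Let $k$ and $n$ be integers with $1\leq k<n$ and $n\geq 14k+24$, and let $G$ be a simple connected graph of order $n$. If $\eta(G)\leq \eta\big(K_1 \vee (K_{n-2-k}+\overline{K_{1+k}})\big)$, then $\mu_f(G)>\frac{n-k}{2}$, unless $G\cong K_1 \vee (K_{n-2-k}+\overline{K_{1+k}})$.
   Context: All graphs are finite, simple, undirected and connected. For a connected graph $G$ with vertices $v_1,\dots,v_n$, $d_G(v_i,v_j)$ is the length of a shortest $v_i$–$v_j$ path, $D(G)=(d_G(v_i,v_j))$ is the distance matrix, $\mathrm{Tr}_G(v_i)=\sum_{j} d_G(v_i,v_j)$ is the transmission of $v_i$, and $\mathrm{Tr}(G)=\mathrm{diag}(\mathrm{Tr}_G(v_1),\dots,\mathrm{Tr}_G(v_n))$. The distance signless Laplacian matrix is $Q(G)=\mathrm{Tr}(G)+D(G)$, and $\eta(G)$ denotes its largest eigenvalue. A fractional matching of $G$ is a function $f:E(G)\to[0,1]$ such that $\sum_{e\ni v} f(e)\leq 1$ for every vertex $v$; the fractional matching number $\mu_f(G)$ is the maximum of $\sum_{e\in E(G)}f(e)$ over all fractional matchings $f$. $K_m$ is the complete graph on $m$ vertices, $\overline{K_m}$ is the edgeless graph on $m$ vertices, $G_1+G_2$ denotes the vertex-disjoint union of $G_1$ and $G_2$, and $G_1\vee G_2$ (join) is obtained from the disjoint union by adding all edges between $V(G_1)$ and $V(G_2)$. *)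

theory Defs
  imports
    "Graph_Theory.Graph_Theory"
    "Jordan_Normal_Form.Char_Poly"
begin

text \<open>
  Finite simple undirected graphs are modelled by the locale \<open>pair_graph\<close>: finite symmetric
  loop-free digraphs without parallel arcs. An undirected edge corresponds to a pair of
  opposite arcs, so notions that refer to edges (matchings, edge sums) go through the set of
  two-element vertex sets below.
\<close>

definition edge_set :: "'a pair_pre_digraph \<Rightarrow> 'a set set" where
  "edge_set G = {{u, v} |u v. (u, v) \<in> parcs G}"


section \<open>The distance signless Laplacian\<close>

definition graph_dist :: "'a pair_pre_digraph \<Rightarrow> 'a \<Rightarrow> 'a \<Rightarrow> nat" where
  "graph_dist G u v = (LEAST l. \<exists>p. pre_digraph.apath (with_proj G) u p v \<and> length p = l)"

definition transmission :: "'a pair_pre_digraph \<Rightarrow> 'a \<Rightarrow> nat" where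
  "transmission G v = (\<Sum>u\<in>pverts G. graph_dist G v u)"

text \<open>
  The matrices are indexed by an arbitrary but fixed enumeration of the vertices. Another
  enumeration conjugates them by a permutation matrix, which does not affect eigenvalues.
\<close>

definition vertex_list :: "'a pair_pre_digraph \<Rightarrow> 'a list" where
  "vertex_list G = (SOME vs. distinct vs \<and> set vs = pverts G)"

definition distance_matrix :: "'a pair_pre_digraph \<Rightarrow> real mat" where
  "distance_matrix G = mat (card (pverts G)) (card (pverts G))
     (\<lambda>(i, j). real (graph_dist G (vertex_list G ! i) (vertex_list G ! j)))"

definition transmission_matrix :: "'a pair_pre_digraph \<Rightarrow> real mat" where
  "transmission_matrix G =
     mat_diag (card (pverts G)) (\<lambda>i. real (transmission G (vertex_list G ! i)))"

definition dist_signless_laplacian :: "'a pair_pre_digraph \<Rightarrow> real mat" where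
  "dist_signless_laplacian G = transmission_matrix G + distance_matrix G"

text \<open>
  The matrix is real symmetric, so its real eigenvalues are all of its eigenvalues, and for a
  nonempty graph the maximum is taken over a finite nonempty set.
\<close>

definition eta :: "'a pair_pre_digraph \<Rightarrow> real" where
  "eta G = Max {x. eigenvalue (dist_signless_laplacian G) x}"


section \<open>Fractional matchings\<close>

definition fractional_matching :: "'a pair_pre_digraph \<Rightarrow> ('a set \<Rightarrow> real) \<Rightarrow> bool" where
  "fractional_matching G f \<longleftrightarrow>
     (\<forall>e\<in>edge_set G. 0 \<le> f e \<and> f e \<le> 1) \<and>
     (\<forall>v\<in>pverts G. (\<Sum>e\<in>{e \<in> edge_set G. v \<in> e}. f e) \<le> 1)"

text \<open>
  The fractional matchings of a finite graph form a nonempty compact set (up to the irrelevant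
  values outside the edge set), so this supremum is attained.
\<close>

definition fractional_matching_number :: "'a pair_pre_digraph \<Rightarrow> real" where
  "fractional_matching_number G = Sup {\<Sum>e\<in>edge_set G. f e |f. fractional_matching G f}"


section \<open>The extremal graph\<close>

definition complete_pgraph :: "nat \<Rightarrow> nat pair_pre_digraph" where
  "complete_pgraph m =
     \<lparr> pverts = {..<m}, parcs = {(i, j). i < m \<and> j < m \<and> i \<noteq> j} \<rparr>"

definition edgeless_pgraph :: "nat \<Rightarrow> nat pair_pre_digraph" where
  "edgeless_pgraph m = \<lparr> pverts = {..<m}, parcs = {} \<rparr>"

definition disjoint_union_pgraph ::
  "'a pair_pre_digraph \<Rightarrow> 'b pair_pre_digraph \<Rightarrow> ('a + 'b) pair_pre_digraph" where
  "disjoint_union_pgraph G H =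
     \<lparr> pverts = pverts G <+> pverts H,
       parcs = map_prod Inl Inl ` parcs G \<union> map_prod Inr Inr ` parcs H \<rparr>"

definition join_pgraph ::
  "'a pair_pre_digraph \<Rightarrow> 'b pair_pre_digraph \<Rightarrow> ('a + 'b) pair_pre_digraph" where
  "join_pgraph G H =
     \<lparr> pverts = pverts (disjoint_union_pgraph G H),
       parcs = parcs (disjoint_union_pgraph G H) \<union>
         (Inl ` pverts G \<times> Inr ` pverts H) \<union> (Inr ` pverts H \<times> Inl ` pverts G) \<rparr>"

definition extremal_graph :: "nat \<Rightarrow> nat \<Rightarrow> (nat + (nat + nat)) pair_pre_digraph" where
  "extremal_graph n k =
     join_pgraph (complete_pgraph 1)
       (disjoint_union_pgraph (complete_pgraph (n - 2 - k)) (edgeless_pgraph (1 + k)))"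

end

theory Submission
  imports Defs "HOL-Analysis.Function_Topology"
begin

text \<open>
  Hall's theorem on the bipartite double cover of \<open>G\<close> shows that a fractional matching number of at
  most \<open>(n - k) / 2\<close> forces an independent set \<open>T\<close> and a set \<open>S\<close> containing all neighbours of
  \<open>T\<close>, with \<open>|T| = |S| + k\<close>. Hence the distances of \<open>G\<close> dominate those of
  the graph obtained by making \<open>S\<close> universal, the remaining vertices outside \<open>T\<close> a clique and \<open>T\<close>
  edgeless, so the Rayleigh quotient of the distance signless Laplacian of \<open>G\<close> is bounded below by
  that of this graph at any vector. Put \<open>s = |S|\<close>.
  If \<open>s > n / 4\<close>, the vector that is 2 on \<open>T\<close> and 1 elsewhere beats \<open>13 n / 5 - 6\<close>, an upper bound for
  the spectral radius of the extremal graph. If \<open>2 \<le> s \<le> n / 4\<close>, the Perron vector of the extremal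
  graph does: going from \<open>s = 1\<close> to \<open>s\<close> lengthens more weighted pairs than it shortens.
  For \<open>s = 1\<close> that same vector forces the distances of \<open>G\<close> to agree with those of the extremal graph.
\<close>

section \<open>Hall's theorem and fractional matchings\<close>

lemma hall_marriage:
  fixes N :: "'a \<Rightarrow> 'b set"
  assumes "finite A" and "\<And>x. x \<in> A \<Longrightarrow> finite (N x)"
    and "\<And>B. B \<subseteq> A \<Longrightarrow> card B \<le> card (\<Union> (N ` B))"
  shows "\<exists>\<phi>. inj_on \<phi> A \<and> (\<forall>x\<in>A. \<phi> x \<in> N x)"
  using assms
proof (induction "card A" arbitrary: A N rule: less_induct)
  case less
  note fin = less.prems(1) and finN = less.prems(2) and hall = less.prems(3)
  have finU: "finite (\<Union> (N ` B))" if "B \<subseteq> A" for B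
    using that fin finN by (meson finite_UN_I finite_subset subsetD)
  show ?case
  proof (cases "A = {}")
    case False
    show ?thesis
    proof (cases "\<exists>B. B \<subset> A \<and> B \<noteq> {} \<and> card (\<Union> (N ` B)) \<le> card B")
      case True
      then obtain B where B: "B \<subset> A" "B \<noteq> {}" "card (\<Union> (N ` B)) \<le> card B"
        by blast
      have finB: "finite B"
        using B fin finite_subset by blast
      have "card B < card A"
        using B fin by (simp add: psubset_card_mono)
      then have "\<exists>\<phi>. inj_on \<phi> B \<and> (\<forall>x\<in>B. \<phi> x \<in> N x)"
        by (rule less.hyps) (use B finB finN hall in blast)+
      then obtain f where f: "inj_on f B" "\<forall>x\<in>B. f x \<in> N x"
        by blast
      let ?N = "\<lambda>x. N x - \<Union> (N ` B)"
      have "card (A - B) < card A"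
        using B fin by (intro psubset_card_mono) auto
      then have "\<exists>\<phi>. inj_on \<phi> (A - B) \<and> (\<forall>x\<in>A - B. \<phi> x \<in> ?N x)"
      proof (rule less.hyps)
        fix C assume C: "C \<subseteq> A - B"
        have finC: "finite C"
          using C fin finite_subset by blast
        have "\<Union> (?N ` C) = \<Union> (N ` (C \<union> B)) - \<Union> (N ` B)"
          by blast
        then have "card (\<Union> (?N ` C)) = card (\<Union> (N ` (C \<union> B))) - card (\<Union> (N ` B))"
          using finU[of B] B by (simp add: card_Diff_subset image_Un)
        moreover have "card (C \<union> B) = card C + card B"
          using finC finB C by (intro card_Un_disjoint) auto
        moreover have "card (C \<union> B) \<le> card (\<Union> (N ` (C \<union> B)))"
          using B C by (intro hall) auto
        ultimately show "card C \<le> card (\<Union> (?N ` C))"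
          using B(3) by linarith
      qed (use fin finN in auto)
      then obtain g where g: "inj_on g (A - B)" "\<forall>x\<in>A - B. g x \<in> ?N x"
        by blast
      let ?h = "\<lambda>x. if x \<in> B then f x else g x"
      have "?h x \<noteq> ?h y" if "x \<in> B" "y \<in> A - B" for x y
      proof -
        have "f x \<in> \<Union> (N ` B)" and "g y \<notin> \<Union> (N ` B)"
          using f(2) g(2) that by blast+
        then show ?thesis
          using that by (metis DiffD2)
      qed
      then have "inj_on ?h (B \<union> (A - B))"
        using f(1) g(1) by (fastforce simp: inj_on_def)
      then have "inj_on ?h A"
        using B(1) by (simp add: Un_absorb1 psubset_imp_subset)
      moreover have "\<forall>x\<in>A. ?h x \<in> N x"
        using f g by auto
      ultimately show ?thesis
        by blast
    next
      case no_tight: False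
      obtain a where a: "a \<in> A"
        using False by blast
      have "card {a} \<le> card (\<Union> (N ` {a}))"
        using a by (intro hall) auto
      then obtain y where y: "y \<in> N a"
        by (cases "N a = {}") auto
      let ?N = "\<lambda>x. N x - {y}"
      have "card (A - {a}) < card A"
        using a fin by (intro psubset_card_mono) auto
      then have "\<exists>\<phi>. inj_on \<phi> (A - {a}) \<and> (\<forall>x\<in>A - {a}. \<phi> x \<in> ?N x)"
      proof (rule less.hyps)
        fix C assume C: "C \<subseteq> A - {a}"
        have eq: "\<Union> (?N ` C) = \<Union> (N ` C) - {y}"
          by blast
        show "card C \<le> card (\<Union> (?N ` C))"
        proof (cases "C = {}")
          case False
          moreover have "C \<subset> A"
            using C a by auto
          ultimately have "card C < card (\<Union> (N ` C))"
            using no_tight by (meson not_le)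
          then show ?thesis
            unfolding eq using card_Diff1_le[of "\<Union> (N ` C)" y]
            by (cases "y \<in> \<Union> (N ` C)") (auto simp: card_Diff_singleton_if)
        qed simp
      qed (use fin finN in auto)
      then obtain g where g: "inj_on g (A - {a})" "\<forall>x\<in>A - {a}. g x \<in> ?N x"
        by blast
      have "g x \<noteq> y" if "x \<in> A - {a}" for x
        using g(2) that by blast
      then have "inj_on (g(a := y)) (insert a (A - {a}))"
        using g(1) unfolding inj_on_insert by (auto simp: inj_on_def)
      then have "inj_on (g(a := y)) A"
        using a by (simp add: insert_absorb)
      moreover have "\<forall>x\<in>A. (g(a := y)) x \<in> N x"
        using g y by auto
      ultimately show ?thesis
        by blast
    qed
  qed simp
qed

text \<open>Giving every element of \<open>A\<close> the same \<open>d\<close> dummy neighbours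
  restores Hall's condition. At most \<open>d\<close> elements are then matched to dummies, and
  dropping them leaves \<open>M\<close>.\<close>

lemma hall_deficiency:
  fixes N :: "'a \<Rightarrow> 'b set"
  assumes "finite A" and "\<And>x. x \<in> A \<Longrightarrow> finite (N x)"
    and "\<And>B. B \<subseteq> A \<Longrightarrow> card B \<le> card (\<Union> (N ` B)) + d"
  shows "\<exists>\<phi> M. M \<subseteq> A \<and> inj_on \<phi> M \<and> (\<forall>x\<in>M. \<phi> x \<in> N x) \<and> card A \<le> card M + d"
proof -
  let ?N = "\<lambda>x. Inl ` N x \<union> Inr ` {..<d}"
  have "\<exists>\<psi>. inj_on \<psi> A \<and> (\<forall>x\<in>A. \<psi> x \<in> ?N x)"
  proof (rule hall_marriage)
    fix B assume B: "B \<subseteq> A"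
    show "card B \<le> card (\<Union> (?N ` B))"
    proof (cases "B = {}")
      case False
      have "finite (\<Union> (N ` B))"
        using B assms(1,2) by (meson finite_UN_I finite_subset subsetD)
      then have "card (\<Union> (N ` B) <+> {..<d}) = card (\<Union> (N ` B)) + d"
        by (simp add: card_Plus)
      moreover have "\<Union> (?N ` B) = \<Union> (N ` B) <+> {..<d}"
        using False by auto
      ultimately show ?thesis
        using assms(3)[OF B] by simp
    qed simp
  qed (use assms in auto)
  then obtain \<psi> where \<psi>: "inj_on \<psi> A" "\<forall>x\<in>A. \<psi> x \<in> ?N x"
    by blast
  define M where "M = {x \<in> A. \<psi> x \<in> range Inl}"
  have "\<psi> ` (A - M) \<subseteq> Inr ` {..<d}"
    using \<psi> by (auto simp: M_def)
  then have "card (\<psi> ` (A - M)) \<le> d"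
    using card_mono[of "Inr ` {..<d}" "\<psi> ` (A - M)"] by (simp add: card_image)
  moreover have "card (\<psi> ` (A - M)) = card (A - M)"
    using \<psi>(1) by (intro card_image) (auto intro: inj_on_subset)
  moreover have "card (A - M) = card A - card M"
    using assms(1) by (intro card_Diff_subset) (auto simp: M_def)
  ultimately have "card A \<le> card M + d"
    by linarith
  moreover have "inj_on (projl \<circ> \<psi>) M"
    using \<psi>(1) unfolding inj_on_def M_def by auto
  moreover have "\<forall>x\<in>M. (projl \<circ> \<psi>) x \<in> N x"
    using \<psi>(2) by (force simp: M_def)
  ultimately show ?thesis
    by (intro exI[of _ "projl \<circ> \<psi>"] exI[of _ M]) (auto simp: M_def)
qed

section \<open>Fractional matchings from the bipartite double cover\<close>

lemma finite_edge_set: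
  assumes "pair_graph G"
  shows "finite (edge_set G)"
proof -
  interpret pair_graph G by fact
  have "edge_set G = (\<lambda>(u, v). {u, v}) ` parcs G"
    by (auto simp: edge_set_def)
  then show ?thesis
    using pair_finite_arcs by simp
qed

text \<open>Each chosen arc \<open>(u, \<phi> u)\<close> is an edge of the bipartite double cover and contributes weight
  one half to the edge of \<open>G\<close> below it.\<close>

lemma fractional_matching_of_inj:
  assumes "pair_graph G" and M: "M \<subseteq> pverts G" and inj: "inj_on \<phi> M"
    and arc: "\<And>u. u \<in> M \<Longrightarrow> (u, \<phi> u) \<in> parcs G"
  shows "\<exists>f. fractional_matching G f \<and> (\<Sum>e\<in>edge_set G. f e) = card M / 2"
proof -
  interpret pair_graph G by fact
  note finE = finite_edge_set[OF \<open>pair_graph G\<close>]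
  have finM: "finite M"
    using M pair_finite_verts finite_subset by blast
  let ?g = "\<lambda>u. {u, \<phi> u}"
  \<comment> \<open>An edge receives 1 when both of its arcs are chosen, and 1/2 when only one
    is.\<close>
  define f where "f e = real (card {u \<in> M. ?g u = e}) / 2" for e
  have gE: "?g u \<in> edge_set G" if "u \<in> M" for u
    using arc[OF that] by (auto simp: edge_set_def)
  have vsum: "(\<Sum>e\<in>{e \<in> edge_set G. v \<in> e}. f e) \<le> 1" for v
  proof -
    let ?M = "{u \<in> M. v \<in> ?g u}"
    have "(\<Sum>e\<in>{e \<in> edge_set G. v \<in> e}. f e)
        = (\<Sum>e\<in>{e \<in> edge_set G. v \<in> e}. \<Sum>u\<in>{u \<in> ?M. ?g u = e}. 1 / 2)"
    proof (rule sum.cong)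
      fix e assume "e \<in> {e \<in> edge_set G. v \<in> e}"
      then have "{u \<in> ?M. ?g u = e} = {u \<in> M. ?g u = e}"
        by auto
      then show "f e = (\<Sum>u\<in>{u \<in> ?M. ?g u = e}. 1 / 2)"
        by (simp add: f_def)
    qed simp
    also have "\<dots> = (\<Sum>u\<in>?M. 1 / 2)"
      by (rule sum.group) (use finM finE gE in auto)
    also have "\<dots> = card ?M / 2"
      by simp
    \<comment> \<open>A chosen arc meets \<open>v\<close> as its tail or as its head. Each happens
      at most once, the latter by injectivity, so the load at \<open>v\<close> is at most twice
      1/2.\<close>
    also have "?M = (M \<inter> {v}) \<union> {u \<in> M. \<phi> u = v}"
      by auto
    also have "card \<dots> \<le> card (M \<inter> {v}) + card {u \<in> M. \<phi> u = v}"
      by (rule card_Un_le)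
    also have "card (M \<inter> {v}) \<le> 1"
      using card_mono[of "{v}" "M \<inter> {v}"] by simp
    also have "card {u \<in> M. \<phi> u = v} \<le> 1"
      using inj finM by (intro card_le_Suc0_iff_eq[THEN iffD2, unfolded One_nat_def[symmetric]])
        (auto dest: inj_onD)
    finally show ?thesis
      by simp
  qed
  have "f e \<le> 1" if e: "e \<in> edge_set G" for e
  proof -
    obtain v where v: "v \<in> e"
      using e by (auto simp: edge_set_def)
    have "f e \<le> (\<Sum>e\<in>{e \<in> edge_set G. v \<in> e}. f e)"
      using e v finE by (intro member_le_sum) (auto simp: f_def)
    with vsum[of v] show ?thesis
      by simp
  qed
  with vsum have "fractional_matching G f"
    by (auto simp: fractional_matching_def f_def)
  moreover have "(\<Sum>e\<in>edge_set G. f e) = (\<Sum>e\<in>edge_set G. \<Sum>u\<in>{u \<in> M. ?g u = e}. 1 / 2)"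
    by (simp add: f_def)
  moreover have "\<dots> = (\<Sum>u\<in>M. 1 / 2)"
    by (rule sum.group) (use finM finE gE in auto)
  ultimately show ?thesis
    by (intro exI[of _ f]) simp
qed

lemma le_fractional_matching_number:
  assumes "pair_graph G" and "fractional_matching G f"
  shows "(\<Sum>e\<in>edge_set G. f e) \<le> fractional_matching_number G"
  unfolding fractional_matching_number_def
proof (rule cSup_upper)
  show "bdd_above {\<Sum>e\<in>edge_set G. f e |f. fractional_matching G f}"
  proof (rule bdd_aboveI)
    fix x assume "x \<in> {\<Sum>e\<in>edge_set G. f e |f. fractional_matching G f}"
    then obtain f where f: "fractional_matching G f" "x = (\<Sum>e\<in>edge_set G. f e)"
      by blast
    have "(\<Sum>e\<in>edge_set G. f e) \<le> (\<Sum>e\<in>edge_set G. 1)"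
      using f by (intro sum_mono) (auto simp: fractional_matching_def)
    with f show "x \<le> (\<Sum>e\<in>edge_set G. 1)"
      by simp
  qed
qed (use assms in blast)

text \<open>If every vertex set had deficiency below \<open>k\<close>, an injection along arcs would
  be defined on more than \<open>n - k\<close> vertices, where \<open>n\<close> is the order of
  \<open>G\<close>, and would give a fractional matching heavier than \<open>(n - k) / 2\<close>. A
  set of large deficiency is then thinned to an independent one.\<close>

lemma fractional_berge_tutte:
  assumes "pair_graph G" and "k > 0"
    and small: "fractional_matching_number G \<le> (real (card (pverts G)) - real k) / 2"
  shows "\<exists>T\<subseteq>pverts G. T \<inter> parcs G `` T = {} \<and> card (parcs G `` T) + k \<le> card T"
proof -
  interpret pair_graph G by fact
  let ?N = "\<lambda>v. parcs G `` {v}"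
  have sub: "parcs G `` B \<subseteq> pverts G" for B
    using in_arcsD2 by auto
  have finN: "finite (parcs G `` B)" for B
    using sub pair_finite_verts finite_subset by blast
  have UN: "\<Union> (?N ` B) = parcs G `` B" for B
    by auto
  have "\<exists>A\<subseteq>pverts G. card (parcs G `` A) + k \<le> card A"
  proof (rule ccontr)
    assume "\<not> ?thesis"
    then have less: "card B < card (parcs G `` B) + k" if "B \<subseteq> pverts G" for B
      using that by (meson not_le)
    \<comment> \<open>The deficiency \<open>k - 1\<close> encodes the strict inequality in integers;
      it is what makes the resulting weight exceed the bound.\<close>
    have "card B \<le> card (\<Union> (?N ` B)) + (k - 1)" if "B \<subseteq> pverts G" for B
      using less[OF that] \<open>k > 0\<close> unfolding UN by linarith
    from hall_deficiency[OF pair_finite_verts finN this]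
    obtain \<phi> M where M: "M \<subseteq> pverts G" "inj_on \<phi> M" "\<forall>x\<in>M. \<phi> x \<in> ?N x"
        "card (pverts G) \<le> card M + (k - 1)"
      by metis
    obtain f where f: "fractional_matching G f" "(\<Sum>e\<in>edge_set G. f e) = card M / 2"
      using fractional_matching_of_inj[OF \<open>pair_graph G\<close> M(1,2)] M(3) by blast
    have "real (card M) / 2 \<le> (real (card (pverts G)) - real k) / 2"
      using le_fractional_matching_number[OF \<open>pair_graph G\<close> f(1)] f(2) small by simp
    moreover have "card (pverts G) < card M + k"
      using M(4) \<open>k > 0\<close> by linarith
    then have "real (card (pverts G)) < real (card M) + real k"
      by linarith
    ultimately show False
      by simp
  qed
  then obtain A where A: "A \<subseteq> pverts G" "card (parcs G `` A) + k \<le> card A"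
    by blast
  have sym: "(v, u) \<in> parcs G" if "(u, v) \<in> parcs G" for u v
    using that pair_sym_arcs by (auto simp: symmetric_def sym_def)
  define T where "T = A - parcs G `` A"
  have finA: "finite A"
    using A(1) pair_finite_verts finite_subset by blast
  have N: "parcs G `` T \<subseteq> parcs G `` A - A"
    using sym by (auto simp: T_def)
  have "card T = card A - card (A \<inter> parcs G `` A)"
    unfolding T_def using finA by (simp add: card_Diff_subset_Int)
  moreover have "card (parcs G `` A - A) = card (parcs G `` A) - card (A \<inter> parcs G `` A)"
    using finA by (simp add: card_Diff_subset_Int Int_commute)
  moreover have "card (parcs G `` T) \<le> card (parcs G `` A - A)"
    using N finN by (intro card_mono) auto
  moreover have "card (A \<inter> parcs G `` A) \<le> card (parcs G `` A)"
    using finN by (intro card_mono) auto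
  ultimately have "card (parcs G `` T) + k \<le> card T"
    using A(2) by linarith
  moreover have "T \<inter> parcs G `` T = {}"
    using N by (auto simp: T_def)
  ultimately show ?thesis
    using A(1) by (intro exI[of _ T]) (auto simp: T_def)
qed

section \<open>The largest eigenvalue as a Rayleigh maximum\<close>

text \<open>Tychonoff's theorem for the topology on the function type; it gives a compact domain on
  which the quadratic form attains its maximum.\<close>

lemma compact_PiE_UNIV:
  fixes S :: "'a \<Rightarrow> 'b::topological_space set"
  assumes "\<And>i. compact (S i)"
  shows "compact (PiE UNIV S)"
  using compactin_PiE[of "\<lambda>_. euclidean" UNIV S] assms
  by (simp add: euclidean_product_topology)

text \<open>The maximum of the Rayleigh quotient of a symmetric form is attained, and a maximiser is an
  eigenvector because the first variation vanishes there.\<close>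

lemma symmetric_form_max:
  fixes q :: "'a \<Rightarrow> 'a \<Rightarrow> real"
  assumes fin: "finite V" and ne: "V \<noteq> {}"
    and sym: "\<And>i j. i \<in> V \<Longrightarrow> j \<in> V \<Longrightarrow> q i j = q j i"
  shows "\<exists>m x. (\<exists>i\<in>V. x i \<noteq> 0) \<and> (\<forall>i\<in>V. (\<Sum>j\<in>V. q i j * x j) = m * x i) \<and>
    (\<forall>y. (\<Sum>i\<in>V. \<Sum>j\<in>V. q i j * y i * y j) \<le> m * (\<Sum>i\<in>V. (y i)\<^sup>2))"
proof -
  define F where "F y = (\<Sum>i\<in>V. \<Sum>j\<in>V. q i j * y i * y j)" for y
  define N where "N y = (\<Sum>i\<in>V. (y i)\<^sup>2)" for y :: "'a \<Rightarrow> real"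
  \<comment> \<open>The unit sphere over \<open>V\<close>. Coordinates outside \<open>V\<close> are
    pinned to 0 because the index type may be infinite; the surrounding box makes the set
    compact.\<close>
  define K where "K = PiE UNIV (\<lambda>i. if i \<in> V then {-1..1} else {0}) \<inter> {x. N x = 1}"
  have cont: "continuous_on S (\<lambda>x::'a \<Rightarrow> real. x i)" for S i
    by (rule continuous_on_subset[OF continuous_on_product_coordinates]) simp
  have "closed {x. N x = 1}"
    unfolding N_def by (intro closed_Collect_eq continuous_intros cont)
  then have "compact K"
    unfolding K_def by (intro compact_Int_closed compact_PiE_UNIV) auto
  moreover have "continuous_on K F"
    unfolding F_def by (intro continuous_intros cont)
  moreover have "K \<noteq> {}"
  proof -
    obtain v where v: "v \<in> V"
      using ne by blast
    let ?x = "\<lambda>i. if i = v then 1 else 0 :: real"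
    have "N ?x = (\<Sum>i\<in>V. if i = v then 1 else 0)"
      unfolding N_def by (intro sum.cong) auto
    then have "?x \<in> K"
      using v fin by (auto simp: K_def)
    then show ?thesis
      by blast
  qed
  ultimately obtain x where x: "x \<in> K" "\<And>y. y \<in> K \<Longrightarrow> F y \<le> F x"
    using continuous_attains_sup by metis
  have Nx: "N x = 1"
    using x(1) by (simp add: K_def)
  define m where "m = F x"
  have bound: "F y \<le> m * N y" for y
  proof (cases "N y = 0")
    case True
    then have "\<forall>i\<in>V. y i = 0"
      using fin by (simp add: N_def sum_nonneg_eq_0_iff)
    then show ?thesis
      using True by (simp add: F_def)
  next
    case False
    have N0: "N y > 0"
      using False by (simp add: N_def sum_nonneg order_less_le)
    \<comment> \<open>Normalising \<open>y\<close>, and cutting it off outside \<open>V\<close>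
      where neither \<open>F\<close> nor \<open>N\<close> looks, gives a point of
      \<open>K\<close>.\<close>
    define z where "z i = (if i \<in> V then y i / sqrt (N y) else 0)" for i
    have Fz: "F z = F y / N y"
      unfolding F_def sum_divide_distrib by (intro sum.cong) (use N0 in \<open>auto simp: z_def\<close>)
    have "N z = (\<Sum>i\<in>V. (y i)\<^sup>2 / N y)"
      unfolding N_def by (intro sum.cong) (use N0 in \<open>auto simp: z_def power_divide N_def\<close>)
    then have Nz: "N z = 1"
      using N0 by (simp add: N_def flip: sum_divide_distrib)
    have "\<bar>z i\<bar> \<le> 1" if "i \<in> V" for i
    proof -
      have "(z i)\<^sup>2 \<le> N z"
        unfolding N_def using that fin by (intro member_le_sum) auto
      then show ?thesis
        using Nz by (simp add: abs_square_le_1)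
    qed
    moreover have "z i = 0" if "i \<notin> V" for i
      using that by (simp add: z_def)
    ultimately have "z \<in> K"
      using Nz by (force simp: K_def)
    then have "F z \<le> m"
      using x(2) by (simp add: m_def)
    then show ?thesis
      using N0 by (simp add: Fz field_simps)
  qed
  have "(\<Sum>j\<in>V. q i j * x j) = m * x i" if i: "i \<in> V" for i
  proof -
    define c where "c = (\<Sum>j\<in>V. q i j * x j) - m * x i"
    define d where "d = q i i - m"
    \<comment> \<open>The left side is \<open>F - m * N\<close> at \<open>x\<close> moved by
      \<open>t\<close> in coordinate \<open>i\<close>. This difference is nowhere positive and
      vanishes at \<open>x\<close>, so its linear coefficient \<open>c\<close> must be 0.\<close>
    have var: "2 * t * c + t\<^sup>2 * d \<le> 0" for t
    proof -
      define e where "e j = (if j = i then t else 0)" for j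
      have "N (\<lambda>j. x j + e j) = (\<Sum>j\<in>V. (x j)\<^sup>2 + (if j = i then 2 * t * x j + t\<^sup>2 else 0))"
        unfolding N_def by (intro sum.cong) (auto simp: e_def power2_eq_square algebra_simps)
      then have N: "N (\<lambda>j. x j + e j) = 1 + 2 * t * x i + t\<^sup>2"
        using fin i Nx by (simp add: sum.distrib N_def)
      have inner: "(\<Sum>k\<in>V. q j k * e k) = t * q j i" for j
      proof -
        have "(\<Sum>k\<in>V. q j k * e k) = (\<Sum>k\<in>V. if k = i then t * q j k else 0)"
          by (intro sum.cong) (auto simp: e_def)
        then show ?thesis
          using fin i by simp
      qed
      have outer: "(\<Sum>j\<in>V. e j * g j) = t * g i" for g
      proof -
        have "(\<Sum>j\<in>V. e j * g j) = (\<Sum>j\<in>V. if j = i then t * g j else 0)"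
          by (intro sum.cong) (auto simp: e_def)
        then show ?thesis
          using fin i by simp
      qed
      define G where "G j = (\<Sum>k\<in>V. q j k * x k)" for j
      have "F (\<lambda>j. x j + e j) = (\<Sum>j\<in>V. (x j + e j) * (G j + (\<Sum>k\<in>V. q j k * e k)))"
        unfolding F_def G_def
        by (intro sum.cong) (auto simp: sum_distrib_left sum.distrib algebra_simps)
      also have "\<dots> = (\<Sum>j\<in>V. x j * G j + t * (x j * q j i) + e j * (G j + t * q j i))"
        unfolding inner by (intro sum.cong) (auto simp: algebra_simps)
      also have "\<dots> = (\<Sum>j\<in>V. x j * G j) + t * (\<Sum>j\<in>V. x j * q j i) + t * (G i + t * q i i)"
        by (simp add: sum.distrib outer sum_distrib_left)
      also have "(\<Sum>j\<in>V. x j * G j) = m"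
        unfolding m_def F_def G_def by (intro sum.cong) (auto simp: sum_distrib_left algebra_simps)
      also have "(\<Sum>j\<in>V. x j * q j i) = G i"
        unfolding G_def using sym i by (intro sum.cong) (auto simp: mult.commute)
      finally have "F (\<lambda>j. x j + e j) = m + 2 * t * (c + m * x i) + t\<^sup>2 * (d + m)"
        by (simp add: c_def d_def G_def power2_eq_square algebra_simps)
      with bound[of "\<lambda>j. x j + e j"] N show ?thesis
        by (simp add: algebra_simps)
    qed
    \<comment> \<open>At \<open>t = u\<close> the linear term dominates: the variation becomes
      \<open>u\<^sup>2\<close> times a positive factor, which forces \<open>u = 0\<close> and hence
      \<open>c = 0\<close>.\<close>
    define u where "u = c / (\<bar>d\<bar> + 1)"
    have c: "c = u * (\<bar>d\<bar> + 1)"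
      by (simp add: u_def)
    have "2 * u * c + u\<^sup>2 * d = u\<^sup>2 * (2 * \<bar>d\<bar> + 2 + d)"
      unfolding c by (simp add: power2_eq_square algebra_simps)
    then have "u\<^sup>2 * (2 * \<bar>d\<bar> + 2 + d) \<le> 0"
      using var[of u] by simp
    moreover have "2 * \<bar>d\<bar> + 2 + d > 0"
      by linarith
    ultimately have "u = 0"
      by (simp add: mult_le_0_iff)
    then show ?thesis
      using c by (simp add: c_def)
  qed
  moreover have "\<exists>i\<in>V. x i \<noteq> 0"
  proof (rule ccontr)
    assume "\<not> (\<exists>i\<in>V. x i \<noteq> 0)"
    then have "N x = 0"
      by (simp add: N_def)
    with Nx show False
      by simp
  qed
  ultimately show ?thesis
    using bound unfolding F_def N_def by (intro exI[of _ m] exI[of _ x]) blast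
qed

section \<open>Matrix eigenvalues as functions on the vertices\<close>

lemma vertex_list:
  assumes "finite (pverts G)"
  shows "distinct (vertex_list G)" "set (vertex_list G) = pverts G"
    and "length (vertex_list G) = card (pverts G)"
proof -
  have "\<exists>vs. distinct vs \<and> set vs = pverts G"
    using finite_distinct_list[OF assms] by blast
  then have "distinct (vertex_list G) \<and> set (vertex_list G) = pverts G"
    unfolding vertex_list_def by (rule someI_ex)
  then show "distinct (vertex_list G)" "set (vertex_list G) = pverts G"
    by auto
  then show "length (vertex_list G) = card (pverts G)"
    by (metis distinct_card)
qed

text \<open>Transporting vectors along the vertex enumeration removes the choice made by
  \<open>vertex_list\<close>. The diagonal transmissions merge with the distances into the factors
  \<open>x i + x j\<close>.\<close>

lemma eigenvalue_dist_signless_laplacian_iff: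
  assumes fin: "finite (pverts G)"
  shows "eigenvalue (dist_signless_laplacian G) e \<longleftrightarrow>
    (\<exists>x. (\<exists>i\<in>pverts G. x i \<noteq> 0) \<and>
      (\<forall>i\<in>pverts G. (\<Sum>j\<in>pverts G. real (graph_dist G i j) * (x i + x j)) = e * x i))"
    (is "_ \<longleftrightarrow> (\<exists>x. ?nz x \<and> ?ev x)")
proof -
  define n where "n = card (pverts G)"
  define vs where "vs = vertex_list G"
  note vl = vertex_list[OF fin, folded vs_def n_def]
  define Q where "Q = dist_signless_laplacian G"
  have bij: "bij_betw ((!) vs) {..<n} (pverts G)"
    using vl by (auto intro!: bij_betw_nth)
  have Q: "Q \<in> carrier_mat n n"
    by (auto simp: Q_def dist_signless_laplacian_def transmission_matrix_def distance_matrix_def n_def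
      mat_diag_def)
  have Qij: "Q $$ (i, j) = (if i = j then real (transmission G (vs ! i)) else 0)
      + real (graph_dist G (vs ! i) (vs ! j))" if "i < n" "j < n" for i j
    using that by (simp add: Q_def dist_signless_laplacian_def transmission_matrix_def
      distance_matrix_def n_def vs_def mat_diag_def)
  have row: "(Q *\<^sub>v v) $ i = (\<Sum>u\<in>pverts G. real (graph_dist G (vs ! i) u) * (x (vs ! i) + x u))"
    if v: "v \<in> carrier_vec n" and i: "i < n" and x: "\<And>i. i < n \<Longrightarrow> v $ i = x (vs ! i)" for v x i
  proof -
    have "(Q *\<^sub>v v) $ i = (\<Sum>j<n. Q $$ (i, j) * v $ j)"
      using Q v i by (simp add: scalar_prod_def atLeast0LessThan)
    also have "\<dots> = (\<Sum>j<n. (if i = j then real (transmission G (vs ! i)) * x (vs ! i) else 0)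
        + real (graph_dist G (vs ! i) (vs ! j)) * x (vs ! j))"
      using i by (intro sum.cong) (auto simp: Qij x algebra_simps)
    also have "\<dots> = real (transmission G (vs ! i)) * x (vs ! i)
        + (\<Sum>j<n. real (graph_dist G (vs ! i) (vs ! j)) * x (vs ! j))"
      using i by (simp add: sum.distrib)
    also have "(\<Sum>j<n. real (graph_dist G (vs ! i) (vs ! j)) * x (vs ! j))
        = (\<Sum>u\<in>pverts G. real (graph_dist G (vs ! i) u) * x u)"
      by (rule sum.reindex_bij_betw[OF bij])
    finally show ?thesis
      by (simp add: transmission_def sum_distrib_left sum.distrib algebra_simps)
  qed
  have "eigenvalue Q e \<longleftrightarrow> (\<exists>x. ?nz x \<and> ?ev x)"
  proof
    assume "eigenvalue Q e"
    then obtain v where v: "v \<in> carrier_vec n" "v \<noteq> 0\<^sub>v n" "Q *\<^sub>v v = e \<cdot>\<^sub>v v"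
      using Q by (auto simp: eigenvalue_def eigenvector_def)
    define x where "x u = v $ (the_inv_into {..<n} ((!) vs) u)" for u
    have x: "v $ i = x (vs ! i)" if "i < n" for i
      using that bij by (simp add: x_def the_inv_into_f_f bij_betw_def)
    obtain i where "i < n" "v $ i \<noteq> 0"
      using v(1,2) by (metis carrier_vecD eq_vecI index_zero_vec(1) index_zero_vec(2))
    then have "?nz x"
      using x bij by (metis bij_betwE lessThan_iff)
    moreover have "?ev x"
    proof
      fix u assume "u \<in> pverts G"
      then obtain i where i: "i < n" "u = vs ! i"
        using bij by (metis bij_betw_imp_surj_on imageE lessThan_iff)
      have "(Q *\<^sub>v v) $ i = e * v $ i"
        using v i(1) by simp
      then show "(\<Sum>j\<in>pverts G. real (graph_dist G u j) * (x u + x j)) = e * x u"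
        using row[OF v(1) i(1) x] x i by simp
    qed
    ultimately show "\<exists>x. ?nz x \<and> ?ev x"
      by blast
  next
    assume "\<exists>x. ?nz x \<and> ?ev x"
    then obtain x where x: "?nz x" "?ev x"
      by blast
    define v where "v = vec n (\<lambda>i. x (vs ! i))"
    have v: "v \<in> carrier_vec n" "\<And>i. i < n \<Longrightarrow> v $ i = x (vs ! i)"
      by (auto simp: v_def)
    obtain i where "i < n" "x (vs ! i) \<noteq> 0"
      using x(1) bij by (metis bij_betw_imp_surj_on imageE lessThan_iff)
    then have "v \<noteq> 0\<^sub>v n"
      using v(2) by force
    moreover have "Q *\<^sub>v v = e \<cdot>\<^sub>v v"
    proof (rule eq_vecI)
      fix i assume "i < dim_vec (e \<cdot>\<^sub>v v)"
      then have i: "i < n"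
        using v(1) by simp
      then have "vs ! i \<in> pverts G"
        using bij by (auto dest: bij_betwE)
      then show "(Q *\<^sub>v v) $ i = (e \<cdot>\<^sub>v v) $ i"
        using row[OF v(1) i v(2)] x(2) i v by simp
    qed (use Q v in auto)
    ultimately show "eigenvalue Q e"
      using Q v(1) by (auto simp: eigenvalue_def eigenvector_def)
  qed
  then show ?thesis
    by (simp add: Q_def)
qed

lemma finite_eigenvalues:
  fixes A :: "'a::field mat"
  assumes "A \<in> carrier_mat n n"
  shows "finite {x. eigenvalue A x}"
proof -
  have "char_poly A \<noteq> 0"
    using degree_monic_char_poly[OF assms] by auto
  then show ?thesis
    using poly_roots_finite by (simp add: eigenvalue_root_char_poly[OF assms])
qed

lemma finite_eigenvalues_dist_signless_laplacian:
  "finite {x. eigenvalue (dist_signless_laplacian G) x}"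
  by (rule finite_eigenvalues[of _ "card (pverts G)"])
    (simp add: dist_signless_laplacian_def transmission_matrix_def distance_matrix_def mat_diag_def)

text \<open>Averaging the double sum with its index-swapped copy produces the squares. Their
  nonnegative weights make the form monotone in the distances \<open>d\<close>.\<close>

lemma symmetric_sum_form:
  fixes x :: "'a \<Rightarrow> real"
  assumes "\<And>i j. i \<in> V \<Longrightarrow> j \<in> V \<Longrightarrow> d i j = d j i"
  shows "(\<Sum>i\<in>V. x i * (\<Sum>j\<in>V. d i j * (x i + x j))) = (\<Sum>i\<in>V. \<Sum>j\<in>V. d i j * ((x i + x j)\<^sup>2 / 2))"
proof -
  let ?s = "\<lambda>i j. d i j * (x i + x j)"
  have "(\<Sum>i\<in>V. \<Sum>j\<in>V. x i * ?s i j) = (\<Sum>j\<in>V. \<Sum>i\<in>V. x i * ?s i j)"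
    by (rule sum.swap)
  also have "\<dots> = (\<Sum>i\<in>V. \<Sum>j\<in>V. x j * ?s i j)"
    using assms by (intro sum.cong) (auto simp: add.commute)
  finally have "2 * (\<Sum>i\<in>V. \<Sum>j\<in>V. x i * ?s i j) = (\<Sum>i\<in>V. \<Sum>j\<in>V. x i * ?s i j + x j * ?s i j)"
    by (simp add: sum.distrib)
  also have "\<dots> = (\<Sum>i\<in>V. \<Sum>j\<in>V. 2 * (d i j * ((x i + x j)\<^sup>2 / 2)))"
    by (intro sum.cong) (auto simp: power2_eq_square algebra_simps)
  also have "\<dots> = 2 * (\<Sum>i\<in>V. \<Sum>j\<in>V. d i j * ((x i + x j)\<^sup>2 / 2))"
    by (simp only: sum_distrib_left)
  finally have "(\<Sum>i\<in>V. \<Sum>j\<in>V. x i * ?s i j) = (\<Sum>i\<in>V. \<Sum>j\<in>V. d i j * ((x i + x j)\<^sup>2 / 2))"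
    by simp
  then show ?thesis
    by (simp only: sum_distrib_left)
qed

section \<open>Distances in a graph and bounds on the largest eigenvalue\<close>

context pair_graph
begin

lemma graph_dist_commute: "graph_dist G u v = graph_dist G v u"
proof -
  have "length (rev_path p) = length p" for p :: "('a \<times> 'a) list"
    by (induction p) auto
  then have "(\<exists>p. apath u p v \<and> length p = l) \<longleftrightarrow> (\<exists>p. apath v p u \<and> length p = l)" for l
    by (metis apath_rev_path)
  then show ?thesis
    unfolding graph_dist_def by simp
qed

lemma graph_dist_le: "apath u p v \<Longrightarrow> graph_dist G u v \<le> length p"
  unfolding graph_dist_def by (rule Least_le) blast

lemma graph_dist_self: "u \<in> pverts G \<Longrightarrow> graph_dist G u u = 0"
  using graph_dist_le[of u "[]" u] by (simp add: apath_Nil_iff)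

lemma graph_dist_arc:
  assumes "(u, v) \<in> parcs G"
  shows "graph_dist G u v \<le> 1"
proof -
  have "apath u [(u, v)] v"
    using assms pair_no_loops[OF assms] in_arcsD1[OF assms] in_arcsD2[OF assms]
    by (auto simp: apath_def awalk_def)
  from graph_dist_le[OF this] show ?thesis
    by simp
qed

lemma graph_dist_common_neighbour:
  assumes "(u, w) \<in> parcs G" "(w, v) \<in> parcs G"
  shows "graph_dist G u v \<le> 2"
proof (cases "u = v")
  case True
  then show ?thesis
    using assms(1) by (simp add: graph_dist_self in_arcsD1)
next
  case False
  then have "apath u [(u, w), (w, v)] v"
    using assms pair_no_loops[OF assms(1)] pair_no_loops[OF assms(2)]
    by (auto simp: apath_def awalk_def in_arcsD1)
  from graph_dist_le[OF this] show ?thesis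
    by simp
qed

text \<open>Connectedness is what makes the \<open>LEAST\<close> in \<open>graph_dist\<close>
  attained. It is phrased through the symmetric closure, which has the same reachability for
  symmetric arcs.\<close>

lemma connected_apath:
  assumes "Digraph_Component.connected (with_proj G)" and "u \<in> pverts G" "v \<in> pverts G"
  obtains p where "apath u p v" "length p = graph_dist G u v"
proof -
  have "u \<rightarrow>\<^sup>*\<^bsub>mk_symmetric (with_proj G)\<^esub> v"
    using assms unfolding connected_def strongly_connected_def by simp
  then have "u \<rightarrow>\<^sup>*\<^bsub>with_proj G\<^esub> v"
    using reachable_mk_symmetric_eq[OF pair_sym_arcs] by simp
  then have "\<exists>l p. apath u p v \<and> length p = l"
    using reachable_apath by blast
  from LeastI_ex[OF this] show thesis
    using that unfolding graph_dist_def by blast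
qed

lemma graph_dist_ge_1:
  assumes "Digraph_Component.connected (with_proj G)" and "u \<in> pverts G" "v \<in> pverts G" and "u \<noteq> v"
  shows "graph_dist G u v \<ge> 1"
proof -
  obtain p where p: "apath u p v" "length p = graph_dist G u v"
    using connected_apath[OF assms(1-3)] .
  have "p \<noteq> []"
    using p(1) \<open>u \<noteq> v\<close> by (auto simp: apath_Nil_iff)
  then show ?thesis
    using p(2) by (cases p) auto
qed

lemma graph_dist_ge_2:
  assumes "Digraph_Component.connected (with_proj G)" and "u \<in> pverts G" "v \<in> pverts G" and "u \<noteq> v"
    and "(u, v) \<notin> parcs G"
  shows "graph_dist G u v \<ge> 2"
proof -
  obtain p where p: "apath u p v" "length p = graph_dist G u v"
    using connected_apath[OF assms(1-3)] .
  have "length p \<noteq> 1"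
  proof
    assume "length p = 1"
    then obtain e where "p = [e]"
      by (auto simp: length_Suc_conv)
    with p(1) have "(u, v) \<in> parcs G"
      by (cases e) (auto simp: apath_def awalk_def)
    with assms(5) show False ..
  qed
  then show ?thesis
    using p(2) graph_dist_ge_1[OF assms(1-4)] by simp
qed

lemma eta_eigenvalue_max:
  assumes "pverts G \<noteq> {}"
  shows "eigenvalue (dist_signless_laplacian G) (eta G)"
    and "(\<Sum>i\<in>pverts G. \<Sum>j\<in>pverts G. real (graph_dist G i j) * ((y i + y j)\<^sup>2 / 2))
      \<le> eta G * (\<Sum>i\<in>pverts G. (y i)\<^sup>2)"
proof -
  let ?V = "pverts G" and ?d = "\<lambda>i j. real (graph_dist G i j)"
  let ?E = "{x. eigenvalue (dist_signless_laplacian G) x}"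
  \<comment> \<open>The distance signless Laplacian itself: transmissions are added on the diagonal.
    Its Rayleigh maximum \<open>m\<close> is an eigenvalue, so the eigenvalue set is nonempty and
    \<open>m \<le> eta G\<close>.\<close>
  define q where "q i j = ?d i j + (if j = i then \<Sum>k\<in>?V. ?d i k else 0)" for i j
  have q: "(\<Sum>j\<in>?V. q i j * x j) = (\<Sum>j\<in>?V. ?d i j * (x i + x j))" if "i \<in> ?V" for i x
  proof -
    have "(\<Sum>j\<in>?V. q i j * x j)
        = (\<Sum>j\<in>?V. ?d i j * x j + (if j = i then (\<Sum>k\<in>?V. ?d i k) * x i else 0))"
      by (intro sum.cong) (auto simp: q_def distrib_right)
    also have "\<dots> = (\<Sum>j\<in>?V. ?d i j * x j) + (\<Sum>k\<in>?V. ?d i k) * x i"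
      using that pair_finite_verts by (simp add: sum.distrib)
    finally show ?thesis
      by (simp add: distrib_left sum.distrib sum_distrib_right)
  qed
  have "q i j = q j i" for i j
    by (simp add: q_def graph_dist_commute)
  then obtain m x where m: "\<exists>i\<in>?V. x i \<noteq> 0" "\<forall>i\<in>?V. (\<Sum>j\<in>?V. q i j * x j) = m * x i"
    "\<And>y. (\<Sum>i\<in>?V. \<Sum>j\<in>?V. q i j * y i * y j) \<le> m * (\<Sum>i\<in>?V. (y i)\<^sup>2)"
    using symmetric_form_max[OF pair_finite_verts assms, of q] by blast
  have "m \<in> ?E"
    using m(1,2) by (auto simp: eigenvalue_dist_signless_laplacian_iff[OF pair_finite_verts] q)
  then show "eigenvalue (dist_signless_laplacian G) (eta G)"
    using Max_in[OF finite_eigenvalues_dist_signless_laplacian, of G] unfolding eta_def by blast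
  have "(\<Sum>i\<in>?V. \<Sum>j\<in>?V. ?d i j * ((y i + y j)\<^sup>2 / 2))
      = (\<Sum>i\<in>?V. y i * (\<Sum>j\<in>?V. ?d i j * (y i + y j)))"
    by (rule symmetric_sum_form[symmetric]) (simp add: graph_dist_commute)
  also have "\<dots> = (\<Sum>i\<in>?V. y i * (\<Sum>j\<in>?V. q i j * y j))"
    by (simp add: q)
  also have "\<dots> = (\<Sum>i\<in>?V. \<Sum>j\<in>?V. q i j * y i * y j)"
    by (simp add: sum_distrib_left mult_ac)
  also have "\<dots> \<le> m * (\<Sum>i\<in>?V. (y i)\<^sup>2)"
    by (rule m(3))
  also have "m \<le> eta G"
    unfolding eta_def using \<open>m \<in> ?E\<close> finite_eigenvalues_dist_signless_laplacian by (intro Max_ge)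
  finally show "(\<Sum>i\<in>?V. \<Sum>j\<in>?V. ?d i j * ((y i + y j)\<^sup>2 / 2)) \<le> eta G * (\<Sum>i\<in>?V. (y i)\<^sup>2)"
    by (simp add: mult_right_mono sum_nonneg)
qed

text \<open>Collatz--Wielandt bound: compare an eigenvector with \<open>y\<close> at a vertex where their ratio is
  largest.\<close>

lemma eta_le:
  assumes ne: "pverts G \<noteq> {}" and pos: "\<And>i. i \<in> pverts G \<Longrightarrow> y i > 0"
    and le: "\<And>i. i \<in> pverts G \<Longrightarrow> (\<Sum>j\<in>pverts G. real (graph_dist G i j) * (y i + y j)) \<le> l * y i"
  shows "eta G \<le> l"
proof -
  let ?V = "pverts G" and ?d = "\<lambda>i j. real (graph_dist G i j)"
  obtain x where x: "\<exists>i\<in>?V. x i \<noteq> 0" "\<forall>i\<in>?V. (\<Sum>j\<in>?V. ?d i j * (x i + x j)) = eta G * x i"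
    using eta_eigenvalue_max(1)[OF ne] unfolding eigenvalue_dist_signless_laplacian_iff[OF pair_finite_verts]
    by blast
  define r where "r i = \<bar>x i\<bar> / y i" for i
  define M where "M = Max (r ` ?V)"
  have "M \<in> r ` ?V"
    unfolding M_def using ne pair_finite_verts by (intro Max_in) auto
  then obtain i where i: "i \<in> ?V" "r i = M"
    by blast
  have "r j \<le> M" if "j \<in> ?V" for j
    unfolding M_def using that pair_finite_verts by (intro Max_ge) auto
  then have xM: "\<bar>x j\<bar> \<le> M * y j" if "j \<in> ?V" for j
    using that pos[OF that] by (fastforce simp: r_def divide_le_eq)
  have xi: "\<bar>x i\<bar> = M * y i"
    using i pos[OF i(1)] by (auto simp: r_def)
  have "M > 0"
  proof -
    obtain k where k: "k \<in> ?V" "x k \<noteq> 0"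
      using x(1) by blast
    then have "0 < M * y k"
      using xM[OF k(1)] by linarith
    then show ?thesis
      using pos[OF k(1)] by (simp add: zero_less_mult_iff)
  qed
  \<comment> \<open>Absolute values are taken throughout because neither \<open>eta G\<close> nor
    the eigenvector \<open>x\<close> is known to have a sign.\<close>
  have "eta G * \<bar>x i\<bar> \<le> \<bar>eta G * x i\<bar>"
    by (simp add: abs_mult mult_right_mono)
  also have "\<dots> = \<bar>\<Sum>j\<in>?V. ?d i j * (x i + x j)\<bar>"
    using x(2) i(1) by simp
  also have "\<dots> \<le> (\<Sum>j\<in>?V. \<bar>?d i j * (x i + x j)\<bar>)"
    by (rule sum_abs)
  also have "\<dots> \<le> (\<Sum>j\<in>?V. M * (?d i j * (y i + y j)))"
  proof (rule sum_mono)
    fix j assume j: "j \<in> ?V"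
    have "\<bar>x i + x j\<bar> \<le> M * (y i + y j)"
      using xM[OF i(1)] xM[OF j] by (simp add: distrib_left)
    then have "?d i j * \<bar>x i + x j\<bar> \<le> ?d i j * (M * (y i + y j))"
      by (rule mult_left_mono) simp
    then show "\<bar>?d i j * (x i + x j)\<bar> \<le> M * (?d i j * (y i + y j))"
      by (simp add: abs_mult mult_ac)
  qed
  also have "\<dots> = M * (\<Sum>j\<in>?V. ?d i j * (y i + y j))"
    by (simp add: sum_distrib_left)
  also have "\<dots> \<le> M * (l * y i)"
    using le[OF i(1)] \<open>M > 0\<close> by (intro mult_left_mono) auto
  also have "\<dots> = l * \<bar>x i\<bar>"
    using xi by simp
  finally show ?thesis
    using xi \<open>M > 0\<close> pos[OF i(1)] by simp
qed

end

section \<open>Numerical estimates\<close>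

text \<open>The quotient of the distance signless Laplacian of the extremal graph has rows given by these
  equations for a vector that is \<open>a\<close> on the hub, 1 on the clique and \<open>c\<close> on the \<open>q\<close> pendant
  vertices. Solving the first two for \<open>a\<close> and \<open>c\<close> leaves one equation in \<open>l\<close>, which has a root by
  the intermediate value theorem.\<close>

lemma extremal_perron:
  fixes n q :: real
  assumes q: "q \<ge> 2" and n: "n \<ge> 14 * q + 10"
  obtains l a c where "0 < a" "0 < c"
    "l * a = (n - 1) * a + (n - 1 - q) + q * c"
    "l = (a + 1) + 2 * (n - 2 - q) + 2 * q * (1 + c)"
    "l * c = (a + c) + 2 * (n - 1 - q) * (c + 1) + 4 * (q - 1) * c"
    "l \<le> 13 / 5 * n - 6"
    "q * (1 + c)\<^sup>2 \<le> 19 / 10 * n + 9 / 2"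
proof -
  \<comment> \<open>The clique row gives \<open>2 * q * c = l - 2 * n + 3 - a\<close>, hence
    \<open>C\<close>. Inserting this into the hub row gives \<open>A\<close>, and
    \<open>F l = 0\<close> is then the pendant row.\<close>
  define A where "A l = (l - 2 * q + 1) / (2 * l - 2 * n + 3)" for l
  define C where "C l = (l - 2 * n + 3 - A l) / (2 * q)" for l
  define F where "F l = (l - 2 * n + 5 - 2 * q) * C l - A l - 2 * (n - 1 - q)" for l
  \<comment> \<open>At \<open>?l0\<close> the factor of \<open>C l\<close> in \<open>F\<close> is
    \<open>3 - 2 * q\<close>, which is negative, so \<open>F\<close> is nonpositive there.
    \<open>?l1\<close> is the bound wanted for \<open>l\<close>, so \<open>F\<close> has to be
    nonnegative there.\<close>
  let ?l0 = "2 * n - 2" and ?l1 = "13 / 5 * n - 6"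
  have l01: "?l0 \<le> ?l1"
    using q n by simp
  have A: "0 < A l \<and> A l < 1" if "l \<ge> ?l0" for l
    using that q n by (simp add: A_def field_simps)
  have C: "C l > 0" if "l \<ge> ?l0" for l
    using that q A[OF that] by (simp add: C_def)
  have "continuous_on {?l0..?l1} F"
    unfolding F_def C_def A_def using q n by (intro continuous_intros) auto
  moreover have "F ?l0 \<le> 0"
  proof -
    have "(3 - 2 * q) * C ?l0 \<le> 0"
      using q C[of ?l0] by (intro mult_nonpos_nonneg) auto
    then show ?thesis
      using A[of ?l0] q n unfolding F_def by simp
  qed
  moreover have "F ?l1 \<ge> 0"
  proof -
    define m where "m = n - 14 * q - 10"
    have n': "n = 14 * q + 10 + m" and m: "m \<ge> 0"
      using n by (auto simp: m_def)
    have c: "C ?l1 \<ge> (3 / 5 * n - 4) / (2 * q)"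
      unfolding C_def using A[OF l01] q by (intro divide_right_mono) auto
    \<comment> \<open>After the substitution \<open>n = 14 * q + 10 + m\<close> every coefficient of
      this polynomial in \<open>q\<close> and \<open>m\<close> is positive.\<close>
    have "(3 / 5 * n - 1 - 2 * q) * (3 / 5 * n - 4) - 2 * q * (2 * n - 1 - 2 * q) \<ge> 0"
      unfolding n' using q m by (simp add: algebra_simps)
    then have "2 * n - 1 - 2 * q \<le> (3 / 5 * n - 1 - 2 * q) * ((3 / 5 * n - 4) / (2 * q))"
      using q by (simp add: field_simps)
    also have "\<dots> \<le> (3 / 5 * n - 1 - 2 * q) * C ?l1"
      using c q n by (intro mult_left_mono) auto
    finally show ?thesis
      using A[OF l01] unfolding F_def by simp
  qed
  ultimately obtain l where l: "?l0 \<le> l" "l \<le> ?l1" "F l = 0"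
    using IVT'[of F ?l0 0 ?l1] l01 by auto
  define a c where "a = A l" and "c = C l"
  have a: "0 < a" "a < 1" and c: "0 < c"
    using A[OF l(1)] C[OF l(1)] by (auto simp: a_def c_def)
  have qc: "2 * q * c = l - 2 * n + 3 - a"
    using q by (simp add: c_def a_def C_def)
  have hub: "a * (2 * l - 2 * n + 3) = l - 2 * q + 1"
    using l(1) q n by (simp add: a_def A_def)
  have pend: "(l - 2 * n + 5 - 2 * q) * c = a + 2 * (n - 1 - q)"
    using l(3) by (simp add: F_def a_def c_def)
  \<comment> \<open>The quadratic term is linearised: \<open>qc\<close> replaces one factor
    \<open>2 * q * c\<close>, and \<open>pend\<close> then evaluates the product with the remaining
    \<open>c\<close>.\<close>
  have "q * c\<^sup>2 \<le> (q - 1) * c + n - 1 / 2 - q"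
  proof -
    have "2 * (q * c\<^sup>2) = (2 * q * c) * c"
      by (simp add: power2_eq_square)
    also have "\<dots> = 2 * (q - 1) * c - a * c + a + 2 * (n - 1 - q)"
      using pend unfolding qc by (simp add: algebra_simps)
    also have "\<dots> \<le> 2 * (q - 1) * c + 1 + 2 * (n - 1 - q)"
      using a mult_pos_pos[OF a(1) c] by linarith
    finally have "2 * (q * c\<^sup>2) \<le> 2 * ((q - 1) * c + n - 1 / 2 - q)"
      by (simp add: algebra_simps)
    then show ?thesis
      by simp
  qed
  moreover have "q * c \<le> 3 / 10 * n - 3 / 2"
    using qc l(2) a by simp
  ultimately have "q * (1 + c)\<^sup>2 \<le> 19 / 10 * n + 9 / 2"
    using c by (simp add: power2_eq_square algebra_simps)
  moreover have "l * a = (n - 1) * a + (n - 1 - q) + q * c"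
    using hub qc by (simp add: algebra_simps)
  moreover have "l = (a + 1) + 2 * (n - 2 - q) + 2 * q * (1 + c)"
    using qc by (simp add: algebra_simps)
  moreover have "l * c = (a + c) + 2 * (n - 1 - q) * (c + 1) + 4 * (q - 1) * c"
    using pend by (simp add: algebra_simps)
  ultimately show thesis
    using that a c l(2) by blast
qed

text \<open>The difference of the two sides is an explicit combination of products that are
  nonnegative for \<open>n / 4 \<le> t \<le> (n + k) / 2\<close>, plus a positive remainder.\<close>

lemma large_separator_ineq:
  fixes n k t :: real
  assumes "0 \<le> k" "14 * k + 24 \<le> n" "n / 4 \<le> t" "2 * t \<le> n + k"
  shows "(13 / 5 * n - 6) * (n + 3 * t)
    < (n - 2) * (n + 3 * t) + (n + t)\<^sup>2 + 9 * t * (n - 2 * t + k) + 8 * t * (t - 1)"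
proof -
  have pos: "0 < 9 * P + 11 / 40 * Q + R" if "0 \<le> P" "0 \<le> Q" "0 < R" for P Q R :: real
    using that by simp
  have "0 < 9 * ((t - n / 4) * ((n + k) / 2 - t)) + 11 / 40 * (n * ((n + k) - 2 * t))
      + (n / 4 * n + 17 / 20 * (n * k) + 9 / 2 * (t * k) + 4 * (t + n))"
    using assms by (intro pos add_nonneg_pos add_nonneg_nonneg mult_nonneg_nonneg) auto
  also have "\<dots> = (n - 2) * (n + 3 * t) + (n + t)\<^sup>2 + 9 * t * (n - 2 * t + k) + 8 * t * (t - 1)
      - (13 / 5 * n - 6) * (n + 3 * t)"
    by (simp add: power2_eq_square field_simps)
  finally show ?thesis
    by simp
qed

section \<open>Distances in the extremal graph\<close>

text \<open>For disjoint \<open>S\<close> and \<open>T\<close> with \<open>S\<close> nonempty, these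
  are the distances in the graph where \<open>S\<close> is universal, \<open>T\<close> is edgeless
  and everything outside \<open>S\<close> and \<open>T\<close> is a clique. Stating them without
  that graph allows entrywise comparison with \<open>graph_dist G\<close>; for
  \<open>S = {h}\<close> they describe the extremal graph.\<close>

definition cone_dist :: "'a set \<Rightarrow> 'a set \<Rightarrow> 'a \<Rightarrow> 'a \<Rightarrow> nat" where
  "cone_dist S T i j =
     (if i = j then 0 else if i \<in> T \<and> j \<notin> S \<or> j \<in> T \<and> i \<notin> S then 2 else 1)"

lemma cone_dist_commute: "cone_dist S T i j = cone_dist S T j i"
  by (auto simp: cone_dist_def)

text \<open>A vector constant on hub, pendants and clique turns each row into one of the three
  quotient equations of \<open>extremal_perron\<close>.\<close>

lemma cone_dist_row:
  fixes a c :: real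
  assumes fin: "finite V" and h: "h \<in> V" "h \<notin> T" and T: "T \<subseteq> V"
    and x: "x = (\<lambda>i. if i = h then a else if i \<in> T then c else 1)"
    and n: "n = real (card V)" and q: "q = real (card T)"
    and i: "i \<in> V"
  shows "(\<Sum>j\<in>V. real (cone_dist {h} T i j) * (x i + x j)) =
    (if i = h then (n - 1) * a + (n - 1 - q) + q * c
     else if i \<in> T then (a + c) + 2 * (n - 1 - q) * (c + 1) + 4 * (q - 1) * c
     else (a + 1) + 2 * (n - 2 - q) + 2 * q * (1 + c))"
proof -
  define R where "R = V - insert h T"
  have V: "V = insert h (T \<union> R)"
    using h T by (auto simp: R_def)
  have fins: "finite T" "finite R"
    using fin T by (auto simp: R_def intro: finite_subset)
  have "card (insert h T) \<le> card V"
    using h T fin by (intro card_mono) auto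
  then have R: "real (card R) = n - 1 - q"
    unfolding R_def n q using h T fins by (subst card_Diff_subset) auto
  have nn: "n = real (card R) + 1 + q"
    using R by simp
  have split: "(\<Sum>j\<in>V. f j) = f h + (\<Sum>j\<in>T. f j) + (\<Sum>j\<in>R. f j)" for f :: "'a \<Rightarrow> real"
  proof -
    have "T \<inter> R = {}" "h \<notin> T \<union> R"
      using h by (auto simp: R_def)
    then show ?thesis
      unfolding V using fins by (simp add: sum.union_disjoint add.assoc)
  qed
  let ?f = "\<lambda>j. real (cone_dist {h} T i j) * (x i + x j)"
  consider "i = h" | "i \<in> T" "i \<noteq> h" | "i \<in> R" "i \<noteq> h" "i \<notin> T"
    using i h by (auto simp: R_def)
  then show ?thesis
  proof cases
    case 1
    have sums: "(\<Sum>j\<in>T. ?f j) = (\<Sum>j\<in>T. a + c)" "(\<Sum>j\<in>R. ?f j) = (\<Sum>j\<in>R. a + 1)"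
      by (intro sum.cong refl; use 1 h in \<open>auto simp: cone_dist_def x R_def\<close>)+
    show ?thesis
      unfolding split sums using 1 by (simp add: cone_dist_def nn q algebra_simps)
  next
    case 2
    \<comment> \<open>The subtracted term removes the diagonal entry \<open>j = i\<close>, where the
      distance is 0; likewise for the clique below.\<close>
    have sums: "(\<Sum>j\<in>T. ?f j) = (\<Sum>j\<in>T. 4 * c - (if j = i then 4 * c else 0))"
      "(\<Sum>j\<in>R. ?f j) = (\<Sum>j\<in>R. 2 * (c + 1))"
      by (intro sum.cong refl; use 2 h in \<open>auto simp: cone_dist_def x R_def\<close>)+
    show ?thesis
      unfolding split sums using 2 h fins by (simp add: sum_subtractf x cone_dist_def nn q algebra_simps)
  next
    case 3
    have sums: "(\<Sum>j\<in>T. ?f j) = (\<Sum>j\<in>T. 2 * (1 + c))"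
      "(\<Sum>j\<in>R. ?f j) = (\<Sum>j\<in>R. 2 - (if j = i then 2 else 0))"
      by (intro sum.cong refl; use 3 h in \<open>auto simp: cone_dist_def x R_def\<close>)+
    show ?thesis
      unfolding split sums using 3 h fins by (simp add: sum_subtractf x cone_dist_def nn q algebra_simps)
  qed
qed

section \<open>Double sums split into blocks of constant weight\<close>

lemma block_sum:
  fixes w :: "'a \<Rightarrow> 'a \<Rightarrow> real"
  assumes "finite V" "A \<subseteq> V" "B \<subseteq> V" and "\<And>i j. i \<in> A \<Longrightarrow> j \<in> B \<Longrightarrow> w i j = r"
  shows "(\<Sum>i\<in>V. \<Sum>j\<in>V. of_bool (i \<in> A \<and> j \<in> B) * w i j) = real (card A) * real (card B) * r"
proof -
  have "(\<Sum>i\<in>V. \<Sum>j\<in>V. of_bool (i \<in> A \<and> j \<in> B) * w i j)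
      = (\<Sum>i\<in>V. if i \<in> A then (\<Sum>j\<in>V. if j \<in> B then r else 0) else 0)"
    using assms(4) by (auto intro!: sum.cong)
  also have "\<dots> = (\<Sum>i\<in>V \<inter> A. \<Sum>j\<in>V \<inter> B. r)"
    using assms(1) by (simp flip: sum.inter_restrict)
  also have "\<dots> = real (card A) * real (card B) * r"
    using assms(2,3) by (simp add: Int_absorb1)
  finally show ?thesis .
qed

lemma diagonal_sum:
  fixes w :: "'a \<Rightarrow> 'a \<Rightarrow> real"
  assumes "finite V" "A \<subseteq> V" and "\<And>i. i \<in> A \<Longrightarrow> w i i = r"
  shows "(\<Sum>i\<in>V. \<Sum>j\<in>V. of_bool (i = j \<and> i \<in> A) * w i j) = real (card A) * r"
proof -
  have "(\<Sum>i\<in>V. \<Sum>j\<in>V. of_bool (i = j \<and> i \<in> A) * w i j)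
      = (\<Sum>i\<in>V. \<Sum>j\<in>V. if i = j then (if i \<in> A then r else 0) else 0)"
    using assms(3) by (auto intro!: sum.cong)
  also have "\<dots> = (\<Sum>i\<in>V. if i \<in> A then r else 0)"
    using assms(1) by (intro sum.cong) auto
  also have "\<dots> = (\<Sum>i\<in>V \<inter> A. r)"
    using assms(1) by (simp flip: sum.inter_restrict)
  finally show ?thesis
    using assms(2) by (simp add: Int_absorb1)
qed

lemma sum_weights:
  shows "(\<Sum>i\<in>V. \<Sum>j\<in>V. (f i j + g i j) * w i j) =
     (\<Sum>i\<in>V. \<Sum>j\<in>V. f i j * w i j) + (\<Sum>i\<in>V. \<Sum>j\<in>V. g i j * w i j :: real)"
    "(\<Sum>i\<in>V. \<Sum>j\<in>V. (f i j - g i j) * w i j) =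
     (\<Sum>i\<in>V. \<Sum>j\<in>V. f i j * w i j) - (\<Sum>i\<in>V. \<Sum>j\<in>V. g i j * w i j :: real)"
    "(\<Sum>i\<in>V. \<Sum>j\<in>V. (r * f i j) * w i j) = r * (\<Sum>i\<in>V. \<Sum>j\<in>V. f i j * w i j :: real)"
  by (simp_all add: distrib_right left_diff_distrib sum.distrib sum_subtractf sum_distrib_left mult.assoc)

section \<open>Graphs given by cone distances: isomorphism and spectral bound\<close>

lemma digraph_isoI:
  assumes "pair_wf_digraph G" and bij: "bij_betw \<phi> (pverts G) (pverts H)"
    and arcs: "parcs H = map_prod \<phi> \<phi> ` parcs G"
  shows "digraph_iso (with_proj G) (with_proj H)"
proof -
  interpret pair_wf_digraph G by fact
  let ?f = "\<lparr>iso_verts = \<phi>, iso_arcs = map_prod \<phi> \<phi>, iso_head = snd, iso_tail = fst\<rparr>"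
  have inj: "inj_on \<phi> (pverts G)"
    using bij by (simp add: bij_betw_def)
  have "inj_on (map_prod \<phi> \<phi>) (parcs G)"
  proof (rule inj_on_subset)
    show "inj_on (map_prod \<phi> \<phi>) (pverts G \<times> pverts G)"
      using inj by (rule map_prod_inj_on[OF _ inj])
    show "parcs G \<subseteq> pverts G \<times> pverts G"
      using in_arcsD1 in_arcsD2 by auto
  qed
  then have "pre_digraph.digraph_isomorphism (with_proj G) ?f"
    using inj wf_digraph_axioms by (auto simp: pre_digraph.digraph_isomorphism_def)
  moreover have "with_proj H = app_iso ?f (with_proj G)"
    using bij arcs by (auto simp: app_iso_def with_proj_def bij_betw_def)
  ultimately show ?thesis
    unfolding digraph_iso_def by blast
qed

text \<open>Such a graph is determined by its order and \<open>card T\<close>: gluing bijections of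
  the hubs, the pendant sets and the remaining vertices preserves \<open>cone_dist\<close>.\<close>

lemma cone_graph_iso:
  assumes "pair_graph G" "finite (pverts H)"
    and G: "h \<in> pverts G" "h \<notin> T" "T \<subseteq> pverts G"
      "parcs G = {(i, j). i \<in> pverts G \<and> j \<in> pverts G \<and> cone_dist {h} T i j = 1}"
    and H: "h' \<in> pverts H" "h' \<notin> T'" "T' \<subseteq> pverts H"
      "parcs H = {(i, j). i \<in> pverts H \<and> j \<in> pverts H \<and> cone_dist {h'} T' i j = 1}"
    and card: "card (pverts G) = card (pverts H)" "card T = card T'"
  shows "digraph_iso (with_proj G) (with_proj H)"
proof -
  interpret pair_graph G by fact
  define R where "R = pverts G - insert h T"
  define R' where "R' = pverts H - insert h' T'"
  have V: "pverts G = {h} \<union> (T \<union> R)" and V': "pverts H = {h'} \<union> (T' \<union> R')"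
    using G(1,3) H(1,3) by (auto simp: R_def R'_def)
  have fin: "finite T" "finite T'" "finite R" "finite R'"
    using G(3) H(3) pair_finite_verts assms(2) by (auto simp: R_def R'_def intro: finite_subset)
  have "card R = card R'"
    unfolding R_def R'_def using G H fin card by (simp add: card_Diff_subset)
  then obtain g where g: "bij_betw g R R'"
    using fin finite_same_card_bij by blast
  obtain f where f: "bij_betw f T T'"
    using fin card(2) finite_same_card_bij by blast
  define \<phi> where "\<phi> i = (if i \<in> {h} then h' else if i \<in> T then f i else g i)" for i
  have bij: "bij_betw \<phi> (pverts G) (pverts H)"
    unfolding V V' \<phi>_def using f g G(2) H(2)
    by (intro bij_betw_disjoint_Un) (auto simp: R_def R'_def bij_betw_def)
  have h: "\<phi> i = h' \<longleftrightarrow> i = h" if "i \<in> pverts G" for i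
    using that bij_betwE[OF f] bij_betwE[OF g] H(2) unfolding V by (auto simp: \<phi>_def R'_def)
  have T: "\<phi> i \<in> T' \<longleftrightarrow> i \<in> T" if "i \<in> pverts G" for i
    using that bij_betwE[OF f] bij_betwE[OF g] H(2) G(2) unfolding V by (auto simp: \<phi>_def R'_def R_def)
  have eq: "\<phi> i = \<phi> j \<longleftrightarrow> i = j" if "i \<in> pverts G" "j \<in> pverts G" for i j
    using that bij by (meson bij_betw_def inj_onD)
  have dist: "cone_dist {h'} T' (\<phi> i) (\<phi> j) = cone_dist {h} T i j"
    if "i \<in> pverts G" "j \<in> pverts G" for i j
    using that by (simp add: cone_dist_def h T eq)
  have "parcs H = map_prod \<phi> \<phi> ` parcs G"
  proof (intro Set.set_eqI iffI)
    fix e assume "e \<in> parcs H"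
    then obtain u v where e: "e = (u, v)" "u \<in> pverts H" "v \<in> pverts H" "cone_dist {h'} T' u v = 1"
      unfolding H(4) by blast
    obtain i j where "i \<in> pverts G" "j \<in> pverts G" "u = \<phi> i" "v = \<phi> j"
      using e(2,3) bij by (metis bij_betw_imp_surj_on imageE)
    then show "e \<in> map_prod \<phi> \<phi> ` parcs G"
      using e dist unfolding G(4) by force
  next
    fix e assume "e \<in> map_prod \<phi> \<phi> ` parcs G"
    then show "e \<in> parcs H"
      using dist bij_betwE[OF bij] unfolding G(4) H(4) by auto
  qed
  then show ?thesis
    using digraph_isoI[OF pair_wf_digraph_axioms bij] by blast
qed

text \<open>The quotient equations make the three-valued vector satisfy the Collatz-Wielandt bound
  \<open>eta_le\<close>. Upper bounds on the distances suffice, and these come from arcs and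
  two-step paths through the hub.\<close>

lemma cone_graph_eta_le:
  fixes a c l :: real
  assumes "pair_graph G"
    and h: "h \<in> pverts G" "h \<notin> T" and T: "T \<subseteq> pverts G"
    and arcs: "parcs G = {(i, j). i \<in> pverts G \<and> j \<in> pverts G \<and> cone_dist {h} T i j = 1}"
    and n: "n = real (card (pverts G))" and q: "q = real (card T)"
    and "0 < a" "0 < c"
    and l: "l * a = (n - 1) * a + (n - 1 - q) + q * c"
      "l = (a + 1) + 2 * (n - 2 - q) + 2 * q * (1 + c)"
      "l * c = (a + c) + 2 * (n - 1 - q) * (c + 1) + 4 * (q - 1) * c"
  shows "eta G \<le> l"
proof -
  interpret pair_graph G by fact
  define x where "x = (\<lambda>i. if i = h then a else if i \<in> T then c else 1)"
  have pos: "x i > 0" for i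
    using \<open>0 < a\<close> \<open>0 < c\<close> by (simp add: x_def)
  have d: "graph_dist G i j \<le> cone_dist {h} T i j" if "i \<in> pverts G" "j \<in> pverts G" for i j
  proof -
    have "i = j \<or> cone_dist {h} T i j = 1 \<or> i \<noteq> h \<and> j \<noteq> h \<and> cone_dist {h} T i j = 2"
      using h(2) by (auto simp: cone_dist_def)
    then consider "i = j" | "cone_dist {h} T i j = 1" | "i \<noteq> h" "j \<noteq> h" "cone_dist {h} T i j = 2"
      by blast
    then show ?thesis
    proof cases
      case 1
      then show ?thesis
        using that by (simp add: graph_dist_self)
    next
      case 2
      then show ?thesis
        using that graph_dist_arc[of i j] arcs by simp
    next
      case 3
      then have "(i, h) \<in> parcs G" "(h, j) \<in> parcs G"
        using that h unfolding arcs by (auto simp: cone_dist_def)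
      with 3 show ?thesis
        using graph_dist_common_neighbour by simp
    qed
  qed
  show ?thesis
  proof (rule eta_le)
    fix i assume i: "i \<in> pverts G"
    have "(\<Sum>j\<in>pverts G. real (graph_dist G i j) * (x i + x j))
        \<le> (\<Sum>j\<in>pverts G. real (cone_dist {h} T i j) * (x i + x j))"
      using d[OF i] pos by (intro sum_mono mult_right_mono) (auto intro: add_nonneg_nonneg less_imp_le)
    also have "\<dots> = l * x i"
      unfolding cone_dist_row[OF pair_finite_verts h T x_def n q i] using l by (simp add: x_def)
    finally show "(\<Sum>j\<in>pverts G. real (graph_dist G i j) * (x i + x j)) \<le> l * x i" .
  qed (use h pos in auto)
qed

lemma extremal_graph_cone:
  fixes n k :: nat
  assumes "k + 2 \<le> n"
  defines "T \<equiv> Inr ` Inr ` {..<1 + k} :: (nat + (nat + nat)) set"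
  shows "card (pverts (extremal_graph n k)) = n" "Inl 0 \<in> pverts (extremal_graph n k)"
    "Inl 0 \<notin> T" "T \<subseteq> pverts (extremal_graph n k)" "card T = 1 + k"
    "parcs (extremal_graph n k) = {(i, j). i \<in> pverts (extremal_graph n k) \<and>
       j \<in> pverts (extremal_graph n k) \<and> cone_dist {Inl 0} T i j = 1}" (is "?A = ?B")
    "pair_graph (extremal_graph n k)"
proof -
  let ?E = "extremal_graph n k"
  have V: "pverts ?E = {..<1} <+> ({..<n - 2 - k} <+> {..<1 + k})"
    by (simp add: extremal_graph_def join_pgraph_def disjoint_union_pgraph_def complete_pgraph_def
      edgeless_pgraph_def)
  show "card (pverts ?E) = n"
    using assms(1) by (simp add: V card_Plus)
  show "Inl 0 \<in> pverts ?E" "Inl 0 \<notin> T" "T \<subseteq> pverts ?E"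
    by (auto simp: V T_def)
  show "card T = 1 + k"
    unfolding T_def by (simp add: card_image image_image inj_on_def)
  show arcs: "?A = ?B"
  proof (rule Set.set_eqI)
    fix e :: "(nat + (nat + nat)) \<times> (nat + (nat + nat))"
    obtain i j where e: "e = (i, j)"
      by (cases e)
    have pi: "(\<exists>x. i = Inl x) \<or> (\<exists>x. i = Inr (Inl x)) \<or> (\<exists>x. i = Inr (Inr x))" for i :: "nat + (nat + nat)"
      by (metis sum.exhaust)
    show "e \<in> ?A \<longleftrightarrow> e \<in> ?B"
      unfolding V e extremal_graph_def join_pgraph_def disjoint_union_pgraph_def
        complete_pgraph_def edgeless_pgraph_def cone_dist_def T_def
      using pi[of i] pi[of j] by (elim disjE exE) (auto simp: image_iff)
  qed
  have "finite (pverts ?E)"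
    by (simp add: V)
  moreover have "?A \<subseteq> pverts ?E \<times> pverts ?E"
    unfolding arcs by blast
  ultimately have "finite ?A"
    by (meson finite_SigmaI finite_subset)
  then show "pair_graph ?E"
    using \<open>finite (pverts ?E)\<close> 
    by unfold_locales (auto simp: arcs symmetric_def sym_def cone_dist_commute cone_dist_def[of _ _ i i for i])
qed

section \<open>Test vectors\<close>

context pair_graph
begin

text \<open>The pairs assigned distance 2 are nonadjacent in \<open>G\<close>, since a vertex of
  \<open>T\<close> has all its neighbours in \<open>S\<close>.\<close>

lemma cone_dist_le_graph_dist:
  assumes conn: "Digraph_Component.connected (with_proj G)"
    and nb: "parcs G `` T \<subseteq> S"
    and ij: "i \<in> pverts G" "j \<in> pverts G"
  shows "cone_dist S T i j \<le> graph_dist G i j"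
proof (cases "i = j")
  case False
  have "(i, j) \<notin> parcs G" if "i \<in> T \<and> j \<notin> S \<or> j \<in> T \<and> i \<notin> S"
    using that nb arcs_symmetric[of i j] by blast
  then show ?thesis
    using False graph_dist_ge_1[OF conn ij] graph_dist_ge_2[OF conn ij] by (simp add: cone_dist_def)
qed (simp add: cone_dist_def)

lemma cone_dist_form_le:
  assumes conn: "Digraph_Component.connected (with_proj G)"
    and nb: "parcs G `` T \<subseteq> S"
    and ne: "pverts G \<noteq> {}"
  shows "(\<Sum>i\<in>pverts G. \<Sum>j\<in>pverts G. real (cone_dist S T i j) * ((x i + x j)\<^sup>2 / 2))
    \<le> eta G * (\<Sum>i\<in>pverts G. (x i)\<^sup>2)"
  using cone_dist_le_graph_dist[OF conn nb]
  by (intro order_trans[OF _ eta_eigenvalue_max(2)[OF ne]] sum_mono mult_right_mono) auto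

text \<open>Test vector: 2 on the independent set \<open>T\<close> and 1 elsewhere.\<close>

lemma large_separator_eta:
  assumes conn: "Digraph_Component.connected (with_proj G)"
    and nb: "parcs G `` T \<subseteq> S"
    and S: "S \<subseteq> pverts G" and T: "T \<subseteq> pverts G" "S \<inter> T = {}"
    and n: "card (pverts G) = n" and card: "card T = card S + k"
    and kn: "14 * k + 24 \<le> n" and s: "n < 4 * card S"
  shows "13 / 5 * real n - 6 < eta G"
proof -
  let ?V = "pverts G"
  define t where "t = real (card T)"
  define x where "x = (\<lambda>i. if i \<in> T then 2 else 1 :: real)"
  define w where "w i j = (x i + x j)\<^sup>2 / 2" for i j
  define C where "C = ?V - (S \<union> T)"
  define R where "R = ?V - T"
  have fin: "finite ?V" "finite S" "finite T"
    using S T pair_finite_verts by (auto intro: finite_subset)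
  have cardST: "card (S \<union> T) = card S + card T"
    using T(2) fin by (simp add: card_Un_disjoint)
  have "card (S \<union> T) \<le> n"
    unfolding n[symmetric] using fin S T by (intro card_mono) auto
  then have tn: "2 * card T \<le> n + k"
    using cardST card by linarith
  have "card C + card (S \<union> T) = n"
    unfolding C_def n[symmetric] using fin S T
    by (metis Un_least add.commute card_Diff_subset card_mono finite_Un le_add_diff_inverse)
  then have cardC: "real (card C) = n - 2 * t + k"
    using cardST card by (simp add: t_def)
  have "card R + card T = n"
    unfolding R_def n[symmetric] using fin T
    by (metis add.commute card_Diff_subset card_mono le_add_diff_inverse)
  then have cardR: "real (card R) = n - t"
    by (simp add: t_def)
  have sub: "C \<subseteq> ?V" "R \<subseteq> ?V"
    by (auto simp: C_def R_def)
  let ?b = "\<lambda>A B i j. of_bool (i \<in> A \<and> j \<in> B) :: real"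
  let ?d = "\<lambda>A i j. of_bool (i = j \<and> i \<in> A) :: real"
  let ?sum = "\<lambda>f. \<Sum>i\<in>?V. \<Sum>j\<in>?V. f i j * w i j"
  \<comment> \<open>The blocks on \<open>R\<close> and \<open>T\<close> without \<open>T\<close>
    times \<open>T\<close> count every such pair once, the \<open>C\<close> blocks raise distances
    between \<open>C\<close> and \<open>T\<close> to 2, and the diagonal terms cancel
    \<open>i = j\<close>.\<close>
  have dist: "real (cone_dist S T i j) = ?b R R i j + ?b R T i j + ?b T R i j + ?b C T i j
      + ?b T C i j + 2 * ?b T T i j - ?d R i j - 2 * ?d T i j"
    if "i \<in> ?V" "j \<in> ?V" for i j
    using that T(2) by (auto simp: cone_dist_def C_def R_def)
  have w: "?sum (?b R R) = real (card R) * real (card R) * 2"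
    "?sum (?b R T) = real (card R) * real (card T) * (9 / 2)"
    "?sum (?b T R) = real (card T) * real (card R) * (9 / 2)"
    "?sum (?b C T) = real (card C) * real (card T) * (9 / 2)"
    "?sum (?b T C) = real (card T) * real (card C) * (9 / 2)"
    "?sum (?b T T) = real (card T) * real (card T) * 8"
    by (rule block_sum[OF fin(1)]; use sub T in \<open>auto simp: w_def x_def R_def C_def power2_eq_square\<close>)+
  have d: "?sum (?d R) = real (card R) * 2" "?sum (?d T) = real (card T) * 8"
    by (rule diagonal_sum[OF fin(1)]; use sub T in \<open>auto simp: w_def x_def R_def power2_eq_square\<close>)+
  have "?sum (\<lambda>i j. real (cone_dist S T i j)) = ?sum (\<lambda>i j. ?b R R i j + ?b R T i j + ?b T R i j
      + ?b C T i j + ?b T C i j + 2 * ?b T T i j - ?d R i j - 2 * ?d T i j)"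
    using dist by (intro sum.cong refl) auto
  also have "\<dots> = (n - t)\<^sup>2 * 2 + 9 * (n - t) * t + 9 * (n - 2 * t + k) * t + 16 * t\<^sup>2
      - 2 * (n - t) - 16 * t"
    unfolding sum_weights w d cardC cardR t_def[symmetric] by (simp add: power2_eq_square algebra_simps)
  also have "\<dots> = (real n - 2) * (n + 3 * t) + (n + t)\<^sup>2 + 9 * t * (n - 2 * t + k) + 8 * t * (t - 1)"
    by (simp add: power2_eq_square algebra_simps)
  also have "\<dots> > (13 / 5 * n - 6) * (n + 3 * t)"
    by (rule large_separator_ineq) (use kn s tn card in \<open>auto simp: t_def\<close>)
  finally have "(13 / 5 * n - 6) * (n + 3 * t) < ?sum (\<lambda>i j. real (cone_dist S T i j))" .
  also have "\<dots> \<le> eta G * (\<Sum>i\<in>?V. (x i)\<^sup>2)"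
    unfolding w_def using n kn by (intro cone_dist_form_le[OF conn nb]) auto
  also have "(\<Sum>i\<in>?V. (x i)\<^sup>2) = (\<Sum>i\<in>?V. 1 + (if i \<in> T then 3 else 0))"
    by (intro sum.cong) (auto simp: x_def)
  also have "\<dots> = n + 3 * t"
    using T fin by (simp add: sum.distrib n t_def Int_absorb1 flip: sum.inter_restrict)
  finally show ?thesis
    using kn by (simp add: t_def mult_less_cancel_right_pos)
qed

text \<open>Test vector: the Perron vector of the extremal graph, with its hub at a vertex of \<open>S\<close> and its
  pendant vertices inside \<open>T\<close>.\<close>

lemma small_separator_form:
  fixes a c l :: real
  assumes h: "h \<in> S" and S: "S \<subseteq> pverts G" and T: "T \<subseteq> pverts G" "S \<inter> T = {}" and T1: "T1 \<subseteq> T"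
    and n: "card (pverts G) = n" and card: "card T = card S + k" "card T1 = k + 1"
    and l: "l * a = (real n - 1) * a + (real n - 1 - real (k + 1)) + real (k + 1) * c"
      "l = (a + 1) + 2 * (real n - 2 - real (k + 1)) + 2 * real (k + 1) * (1 + c)"
      "l * c = (a + c) + 2 * (real n - 1 - real (k + 1)) * (c + 1) + 4 * (real (k + 1) - 1) * c"
    and x: "x = (\<lambda>i. if i = h then a else if i \<in> T1 then c else 1)"
  shows "(\<Sum>i\<in>pverts G. \<Sum>j\<in>pverts G. real (cone_dist S T i j) * ((x i + x j)\<^sup>2 / 2))
    = l * (\<Sum>i\<in>pverts G. (x i)\<^sup>2) + (real (card S) - 1) *
      (4 * (real n - 2 * real (card S) - real k) + 2 * (real (card S) - 2) - real (k + 1) * (1 + c)\<^sup>2)"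
proof -
  let ?V = "pverts G"
  define s where "s = real (card S)"
  define w where "w i j = (x i + x j)\<^sup>2 / 2" for i j
  define C where "C = ?V - (S \<union> T)"
  define U where "U = T - T1"
  define S' where "S' = S - {h}"
  have fin: "finite ?V" "finite S" "finite T" "finite T1"
    using S T(1) subset_trans[OF T1 T(1)] pair_finite_verts by (auto intro: finite_subset)
  have cardST: "card (S \<union> T) = card S + card T"
    using T(2) fin by (simp add: card_Un_disjoint)
  have "card C + card (S \<union> T) = n"
    unfolding C_def n[symmetric] using fin S T
    by (metis Un_least add.commute card_Diff_subset card_mono finite_Un le_add_diff_inverse)
  then have cardC: "real (card C) = n - 2 * s - k"
    using cardST card by (simp add: s_def)
  have "card U + card T1 = card T"
    unfolding U_def using fin T1
    by (metis add.commute card_Diff_subset card_mono le_add_diff_inverse)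
  then have cardU: "real (card U) = s - 1"
    using card by (simp add: s_def)
  have "card S > 0"
    using h fin by (auto simp: card_gt_0_iff)
  then have cardS': "real (card S') = s - 1"
    using h by (simp add: S'_def s_def)
  have hV: "h \<in> ?V" "h \<notin> T1" "T1 \<subseteq> ?V"
    using h S T T1 by auto
  have sub: "C \<subseteq> ?V" "U \<subseteq> ?V" "S' \<subseteq> ?V"
    using S T by (auto simp: C_def U_def S'_def)
  let ?b = "\<lambda>A B i j. of_bool (i \<in> A \<and> j \<in> B) :: real"
  let ?d = "\<lambda>A i j. of_bool (i = j \<and> i \<in> A) :: real"
  let ?sum = "\<lambda>f. \<Sum>i\<in>?V. \<Sum>j\<in>?V. f i j * w i j"
  \<comment> \<open>The five classes hub, \<open>S'\<close>, \<open>T1\<close>, \<open>U\<close> and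
    \<open>C\<close> partition the vertices. Recording every membership lets \<open>dist\<close> be
    checked class by class.\<close>
  have cls: "i = h \<and> i \<in> S \<and> i \<notin> S' \<and> i \<notin> T \<and> i \<notin> T1 \<and> i \<notin> U \<and> i \<notin> C
      \<or> i \<noteq> h \<and> i \<in> S \<and> i \<in> S' \<and> i \<notin> T \<and> i \<notin> T1 \<and> i \<notin> U \<and> i \<notin> C
      \<or> i \<noteq> h \<and> i \<notin> S \<and> i \<notin> S' \<and> i \<in> T \<and> i \<in> T1 \<and> i \<notin> U \<and> i \<notin> C
      \<or> i \<noteq> h \<and> i \<notin> S \<and> i \<notin> S' \<and> i \<in> T \<and> i \<notin> T1 \<and> i \<in> U \<and> i \<notin> C
      \<or> i \<noteq> h \<and> i \<notin> S \<and> i \<notin> S' \<and> i \<notin> T \<and> i \<notin> T1 \<and> i \<notin> U \<and> i \<in> C" if "i \<in> ?V" for i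
    using that T(2) T1 h unfolding C_def U_def S'_def by blast
  \<comment> \<open>Compared with hub \<open>h\<close> and pendants \<open>T1\<close>, pairs inside
    \<open>U\<close> and between \<open>U\<close> and \<open>C\<close> lengthen from 1 to 2, while
    pairs between \<open>S'\<close> and \<open>T1\<close> shorten from 2 to 1. Both \<open>U\<close>
    and \<open>S'\<close> have \<open>s - 1\<close> vertices, whence the common factor.\<close>
  have dist: "real (cone_dist S T i j) = real (cone_dist {h} T1 i j) + ?b U C i j + ?b C U i j
      + ?b U U i j - ?d U i j - ?b S' T1 i j - ?b T1 S' i j"
    if "i \<in> ?V" "j \<in> ?V" for i j
    using cls[OF that(1)] cls[OF that(2)]
    by (elim disjE conjE; cases "i = j"; simp add: cone_dist_def)
  have w: "?sum (?b U C) = real (card U) * real (card C) * 2"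
    "?sum (?b C U) = real (card C) * real (card U) * 2"
    "?sum (?b U U) = real (card U) * real (card U) * 2"
    "?sum (?b S' T1) = real (card S') * real (card T1) * ((1 + c)\<^sup>2 / 2)"
    "?sum (?b T1 S') = real (card T1) * real (card S') * ((1 + c)\<^sup>2 / 2)"
    by (rule block_sum[OF fin(1)];
        use sub hV h T T1 in \<open>auto simp: w_def x U_def C_def S'_def add.commute\<close>)+
  have d: "?sum (?d U) = real (card U) * 2"
    by (rule diagonal_sum[OF fin(1)]; use sub h T in \<open>auto simp: w_def x U_def\<close>)
  have "?sum (\<lambda>i j. real (cone_dist {h} T1 i j)) =
      (\<Sum>i\<in>?V. x i * (\<Sum>j\<in>?V. real (cone_dist {h} T1 i j) * (x i + x j)))"
    unfolding w_def by (rule symmetric_sum_form[symmetric]) (simp add: cone_dist_commute)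
  also have "\<dots> = (\<Sum>i\<in>?V. x i * (l * x i))"
    by (intro sum.cong refl arg_cong2[where f = "(*)"] trans[OF cone_dist_row[OF fin(1) hV x]])
      (use l in \<open>auto simp: x n card(2)\<close>)
  also have "\<dots> = l * (\<Sum>i\<in>?V. (x i)\<^sup>2)"
    by (simp add: sum_distrib_left power2_eq_square mult_ac)
  finally have cone: "?sum (\<lambda>i j. real (cone_dist {h} T1 i j)) = l * (\<Sum>i\<in>?V. (x i)\<^sup>2)" .
  have "?sum (\<lambda>i j. real (cone_dist S T i j)) = ?sum (\<lambda>i j. real (cone_dist {h} T1 i j)
      + ?b U C i j + ?b C U i j + ?b U U i j - ?d U i j - ?b S' T1 i j - ?b T1 S' i j)"
    using dist by (intro sum.cong refl) auto
  also have "\<dots> = l * (\<Sum>i\<in>?V. (x i)\<^sup>2) + (s - 1) *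
      (4 * (real n - 2 * s - k) + 2 * (s - 2) - real (k + 1) * (1 + c)\<^sup>2)"
    unfolding sum_weights w d cone cardC cardU cardS' card(2) by (simp add: algebra_simps)
  finally show ?thesis
    unfolding w_def s_def .
qed

text \<open>All weights are positive, so a single distance above its cone value would push the
  Rayleigh quotient beyond \<open>eta G\<close>. Hence all distances agree, and adjacency is
  distance 1.\<close>

lemma unique_separator_cone:
  fixes x :: "'a \<Rightarrow> real"
  assumes conn: "Digraph_Component.connected (with_proj G)"
    and nb: "parcs G `` T \<subseteq> {h}"
    and ne: "pverts G \<noteq> {}" and pos: "\<And>i. x i > 0"
    and eq: "eta G * (\<Sum>i\<in>pverts G. (x i)\<^sup>2) \<le>
      (\<Sum>i\<in>pverts G. \<Sum>j\<in>pverts G. real (cone_dist {h} T i j) * ((x i + x j)\<^sup>2 / 2))"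
  shows "parcs G = {(i, j). i \<in> pverts G \<and> j \<in> pverts G \<and> cone_dist {h} T i j = 1}"
proof -
  let ?V = "pverts G"
  have w: "(x i + x j)\<^sup>2 / 2 > 0" for i j
    using pos[of i] pos[of j] by (simp add: add_pos_pos less_imp_neq[symmetric])
  note le = cone_dist_le_graph_dist[OF conn nb]
  have eqd: "graph_dist G i j = cone_dist {h} T i j" if i: "i \<in> ?V" and j: "j \<in> ?V" for i j
  proof (rule ccontr)
    assume "graph_dist G i j \<noteq> cone_dist {h} T i j"
    then have lt: "cone_dist {h} T i j < graph_dist G i j"
      using le[OF i j] by simp
    have "(\<Sum>i\<in>?V. \<Sum>j\<in>?V. real (cone_dist {h} T i j) * ((x i + x j)\<^sup>2 / 2))
        < (\<Sum>i\<in>?V. \<Sum>j\<in>?V. real (graph_dist G i j) * ((x i + x j)\<^sup>2 / 2))"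
    proof (rule sum_strict_mono_ex1[OF pair_finite_verts])
      show "\<forall>i\<in>?V. (\<Sum>j\<in>?V. real (cone_dist {h} T i j) * ((x i + x j)\<^sup>2 / 2))
          \<le> (\<Sum>j\<in>?V. real (graph_dist G i j) * ((x i + x j)\<^sup>2 / 2))"
        using le by (intro ballI sum_mono mult_right_mono) auto
      have "(\<Sum>j\<in>?V. real (cone_dist {h} T i j) * ((x i + x j)\<^sup>2 / 2))
          < (\<Sum>j\<in>?V. real (graph_dist G i j) * ((x i + x j)\<^sup>2 / 2))"
      proof (rule sum_strict_mono_ex1[OF pair_finite_verts])
        show "\<forall>j\<in>?V. real (cone_dist {h} T i j) * ((x i + x j)\<^sup>2 / 2)
            \<le> real (graph_dist G i j) * ((x i + x j)\<^sup>2 / 2)"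
          using le i by (intro ballI mult_right_mono) auto
        show "\<exists>j\<in>?V. real (cone_dist {h} T i j) * ((x i + x j)\<^sup>2 / 2)
            < real (graph_dist G i j) * ((x i + x j)\<^sup>2 / 2)"
          using lt j w[of i j] by (intro bexI[of _ j] mult_strict_right_mono) auto
      qed
      then show "\<exists>i\<in>?V. (\<Sum>j\<in>?V. real (cone_dist {h} T i j) * ((x i + x j)\<^sup>2 / 2))
          < (\<Sum>j\<in>?V. real (graph_dist G i j) * ((x i + x j)\<^sup>2 / 2))"
        using i by blast
    qed
    with eq eta_eigenvalue_max(2)[OF ne, of x] show False
      by linarith
  qed
  have "(i, j) \<in> parcs G \<longleftrightarrow> cone_dist {h} T i j = 1" if i: "i \<in> ?V" and j: "j \<in> ?V" for i j
  proof
    assume arc: "(i, j) \<in> parcs G"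
    have "i \<noteq> j"
      using pair_no_loops[OF arc] by simp
    then show "cone_dist {h} T i j = 1"
      using graph_dist_arc[OF arc] graph_dist_ge_1[OF conn i j] eqd[OF i j] by simp
  next
    assume one: "cone_dist {h} T i j = 1"
    then have "i \<noteq> j"
      by (auto simp: cone_dist_def)
    then show "(i, j) \<in> parcs G"
      using graph_dist_ge_2[OF conn i j] eqd[OF i j] one by force
  qed
  then show ?thesis
    using in_arcsD1 in_arcsD2 by blast
qed

end

section \<open>Case analysis on the size of the separator\<close>

theorem theorem3p1:
  fixes G :: "'a pair_pre_digraph" and k n :: nat
  assumes "1 \<le> k" and "k < n" and "n \<ge> 14 * k + 24"
    and "pair_graph G"
    and "Digraph_Component.connected (with_proj G)"
    and "card (pverts G) = n"
    and "eta G \<le> eta (extremal_graph n k)"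
  shows "fractional_matching_number G > (real n - real k) / 2
         \<or> digraph_iso (with_proj G) (with_proj (extremal_graph n k))"
proof (rule disj_imp[THEN iffD2], rule impI)
  assume small: "\<not> fractional_matching_number G > (real n - real k) / 2"
  interpret pair_graph G by fact
  let ?E = "extremal_graph n k"
  note kn = assms(1,3) and conn = assms(5) and n = assms(6)
  have ne: "pverts G \<noteq> {}"
    using n kn by auto
  obtain T0 where T0: "T0 \<subseteq> pverts G" "T0 \<inter> parcs G `` T0 = {}" "card (parcs G `` T0) + k \<le> card T0"
    using fractional_berge_tutte[OF assms(4), of k] small n kn by auto
  define S where "S = parcs G `` T0"
  \<comment> \<open>\<open>T0\<close> is trimmed to make the deficiency exactly \<open>k\<close>,
    while \<open>S\<close> stays the neighbourhood of all of \<open>T0\<close> and so still contains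
    that of \<open>T\<close>.\<close>
  obtain T where T: "T \<subseteq> T0" "card T = card S + k"
    using T0(3) unfolding S_def by (meson obtain_subset_with_card_n)
  have nb: "parcs G `` T \<subseteq> S" and disj: "S \<inter> T = {}"
    and TV: "T \<subseteq> pverts G"
    using T(1) T0(1,2) unfolding S_def by blast+
  have SV: "S \<subseteq> pverts G"
    using in_arcsD2 by (auto simp: S_def)
  have fin: "finite S" "finite T"
    using SV TV pair_finite_verts by (auto intro: finite_subset)
  \<comment> \<open>A vertex of \<open>T\<close> has a neighbour: the first arc of a path to any
    other vertex leads into \<open>S\<close>.\<close>
  have "S \<noteq> {}"
  proof -
    obtain u where u: "u \<in> T"
      using T(2) kn by fastforce
    have "\<exists>v\<in>pverts G. v \<noteq> u"
    proof (rule ccontr)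
      assume "\<not> ?thesis"
      then have "pverts G \<subseteq> {u}"
        by blast
      from card_mono[OF _ this] n kn show False
        by simp
    qed
    then obtain v where v: "v \<in> pverts G" "v \<noteq> u"
      by blast
    obtain p where p: "apath u p v"
      using connected_apath[OF conn] u TV v by blast
    then obtain e p' where "p = e # p'"
      using v by (cases p) (auto simp: apath_Nil_iff)
    then have "(u, snd e) \<in> parcs G"
      using p by (cases e) (auto simp: apath_def awalk_def)
    then show ?thesis
      using u nb by blast
  qed
  then obtain h where h: "h \<in> S"
    by blast
  obtain T1 where T1: "T1 \<subseteq> T" "card T1 = k + 1"
  proof -
    have "k + 1 \<le> card T"
      using T(2) \<open>S \<noteq> {}\<close> fin by (simp add: Suc_leI card_gt_0_iff)
    then show thesis
      using that by (meson obtain_subset_with_card_n)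
  qed
  obtain l a c where ac: "0 < a" "0 < c"
    and l: "l * a = (real n - 1) * a + (real n - 1 - real (k + 1)) + real (k + 1) * c"
      "l = (a + 1) + 2 * (real n - 2 - real (k + 1)) + 2 * real (k + 1) * (1 + c)"
      "l * c = (a + c) + 2 * (real n - 1 - real (k + 1)) * (c + 1) + 4 * (real (k + 1) - 1) * c"
    and l_le: "l \<le> 13 / 5 * real n - 6" and qc: "real (k + 1) * (1 + c)\<^sup>2 \<le> 19 / 10 * real n + 9 / 2"
  proof (rule extremal_perron[of "real (k + 1)" "real n"])
    \<comment> \<open>With \<open>q = k + 1\<close> the requirement
      \<open>14 * q + 10 \<le> n\<close> is exactly \<open>14 * k + 24 \<le> n\<close>.\<close>
    show "2 \<le> real (k + 1)" "14 * real (k + 1) + 10 \<le> real n"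
      using kn of_nat_mono[OF kn(2), where 'a = real] by simp_all
  qed (rule that)
  have "k + 2 \<le> n"
    using kn by linarith
  note ext = extremal_graph_cone[OF this]
  have "eta ?E \<le> l"
    by (rule cone_graph_eta_le[OF ext(7,2-4,6) _ _ ac]) (use l ext(1,5) in auto)
  then have eta_le: "eta G \<le> l"
    using assms(7) by linarith
  define x where "x = (\<lambda>i. if i = h then a else if i \<in> T1 then c else 1)"
  have pos: "x i > 0" for i
    using ac by (simp add: x_def)
  let ?N = "\<Sum>i\<in>pverts G. (x i)\<^sup>2"
  have N: "?N > 0"
    by (intro sum_pos zero_less_power pos pair_finite_verts ne)
  note form = small_separator_form[OF h SV TV disj T1(1) n T(2) T1(2) l x_def]
  have "eta G * ?N \<le> l * ?N"
    using eta_le N by simp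
  have "\<not> n < 4 * card S"
    using large_separator_eta[OF conn nb SV TV disj n T(2)] eta_le l_le kn by auto
  then have sn: "4 * real (card S) \<le> real n"
    by linarith
  have "card S = 1"
  proof (rule ccontr)
    assume "card S \<noteq> 1"
    moreover have "card S > 0"
      using h fin by (auto simp: card_gt_0_iff)
    ultimately have "2 \<le> card S"
      by linarith
    moreover have "14 * real k + 24 \<le> real n"
      using kn by linarith
    \<comment> \<open>By \<open>sn\<close> and \<open>qc\<close> the bracket is at least
      \<open>6 / 10 * n - 4 * k - 17 / 2\<close>, which is positive for
      \<open>n \<ge> 14 * k + 24\<close>.\<close>
    ultimately have "0 < (real (card S) - 1) *
      (4 * (real n - 2 * real (card S) - real k) + 2 * (real (card S) - 2) - real (k + 1) * (1 + c)\<^sup>2)"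
      using qc sn by (intro mult_pos_pos) auto
    then show False
      using form cone_dist_form_le[OF conn nb ne, of x] \<open>eta G * ?N \<le> l * ?N\<close> by linarith
  qed
  then have S: "S = {h}"
    using h by (auto simp: card_Suc_eq)
  \<comment> \<open>With a single separator vertex \<open>T\<close> has exactly \<open>k + 1\<close>
    elements, so \<open>form\<close> loses its correction term and supplies the equality
    case.\<close>
  have "T1 = T"
    using T1 T(2) \<open>card S = 1\<close> fin by (intro card_subset_eq) auto
  have arcs: "parcs G = {(i, j). i \<in> pverts G \<and> j \<in> pverts G \<and> cone_dist {h} T i j = 1}"
    by (rule unique_separator_cone[where x = x, OF conn _ ne pos])
      (use nb form \<open>eta G * ?N \<le> l * ?N\<close> in \<open>simp_all add: S\<close>)
  show "digraph_iso (with_proj G) (with_proj ?E)"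
  proof (rule cone_graph_iso[OF assms(4) _ _ _ TV arcs ext(2-4,6)])
    show "finite (pverts ?E)"
      using ext(1) kn by (metis card.infinite le_zero_eq add_is_0 zero_neq_numeral)
  qed (use h SV disj n ext T(2) \<open>card S = 1\<close> in auto)
qed

end
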